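(* Let $S$ be an inverse semigroup. Then $G_u(S^{\mathrm{ab}})$ is isomorphic (as an étale topological groupoid) to $G_u(S)^{\mathrm{ab}}$.
   Context: An inverse semigroup is a semigroup $S$ in which every $s$ has a unique $s^*$ with $s=ss^*s$, $s^*=s^*ss^*$. $E(S)$ is the (commutative) semigroup of idempotents. Let $\mathbb{T}=\{z\in\mathbb{C}:|z|=1\}$ and regard $\mathbb{T}\cup\{0\}$ as an inverse semigroup under multiplication; $\widehat{S}$ is the set of all semigroup homomorphisms $S\to\mathbb{T}\cup\{0\}$. Let $\nu_{\mathrm{ab}}$ be the congruence on $S$ of all pairs $(s,t)$ with $\varphi(s)=\varphi(t)$ for all $\varphi\in\widehat{S}$, and $S^{\mathrm{ab}}=S/\nu_{\mathrm{ab}}$, an inverse semigroup. $\widehat{E(S)}$ is the set of nonzero semigroup homomorphisms $E(S)\to\{0,1\}$ with the topology of pointwise convergence. For $e\in E(S)$ let $D_e=\{\xi\in\widehat{E(S)}:\xi(e)=1\}$; for $s\in S$ and $\xi\in D_{s^*s}$ let $\beta_s(\xi)\in D_{ss^*}$ be $\beta_s(\xi)(e)=\xi(s^*es)$. Universal groupoid $G_u(S)$: the set of classes $[s,\xi]$ of pairs $(s,\xi)\in S\times\widehat{E(S)}$ with $\xi(s^*s)=1$, where $(s,\xi)\sim(t,\eta)$ iff $\xi=\eta$ and there is $e\in E(S)$ with $\xi(e)=1$ and $se=te$. The unit space is $\widehat{E(S)}$ (via $\xi\mapsto[e,\xi]$ for any $e$ with $\xi(e)=1$), $d([s,\xi])=\xi$,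 $r([s,\xi])=\beta_s(\xi)$, $[s,\beta_t(\xi)][t,\xi]=[st,\xi]$, $[s,\xi]^{-1}=[s^*,\beta_s(\xi)]$. The sets $\{[s,\xi]:\xi\in U\}$, with $s\in S$ and $U\subset D_{s^*s}$ open, form a basis of the topology; $G_u(S)$ is an étale groupoid. For an étale groupoid $G$: a unit $x\in G^{(0)}$ is a fixed point if $d(\alpha)=x$ implies $r(\alpha)=x$; with $F$ the set of all fixed points, $G_{\mathrm{fix}}=d^{-1}(F)$ with the relative topology, which is a bundle of groups $(G_{\mathrm{fix}})_x=d^{-1}(x)$, $x\in F$. Let $[G_{\mathrm{fix}},G_{\mathrm{fix}}]=\bigcup_{x\in F}[(G_{\mathrm{fix}})_x,(G_{\mathrm{fix}})_x]$ be the union of commutator subgroups, which is an open normal subgroupoid of $G_{\mathrm{fix}}$. Then $G^{\mathrm{ab}}=G_{\mathrm{fix}}/[G_{\mathrm{fix}},G_{\mathrm{fix}}]$, where for an open normal subgroupoid $H$ of $G$, $G/H$ is the quotient by $\alpha\sim\beta$ iff $d(\alpha)=d(\beta)$ and $\alpha\beta^{-1}\in H$, with the induced groupoid structure and the quotient topology. *)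

theory Defs
  imports "HOL-Analysis.Analysis" "HOL-Algebra.Generated_Groups"
begin

section \<open>Inverse semigroups and their abelianization\<close>

record 'a sgrp = "'a partial_object" +
  sprod :: "'a \<Rightarrow> 'a \<Rightarrow> 'a" (infixl \<open>\<cdot>\<index>\<close> 70)

definition is_star :: "'a sgrp \<Rightarrow> 'a \<Rightarrow> 'a \<Rightarrow> bool" where
  "is_star S s t \<longleftrightarrow>
     t \<in> carrier S \<and> s = s \<cdot>\<^bsub>S\<^esub> t \<cdot>\<^bsub>S\<^esub> s \<and> t = t \<cdot>\<^bsub>S\<^esub> s \<cdot>\<^bsub>S\<^esub> t"

locale inverse_semigroup =
  fixes S :: "'a sgrp" (structure)
  assumes closed: "\<lbrakk>s \<in> carrier S; t \<in> carrier S\<rbrakk> \<Longrightarrow> s \<cdot> t \<in> carrier S"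
    and assoc: "\<lbrakk>s \<in> carrier S; t \<in> carrier S; u \<in> carrier S\<rbrakk> \<Longrightarrow> (s \<cdot> t) \<cdot> u = s \<cdot> (t \<cdot> u)"
    and ex1_star: "s \<in> carrier S \<Longrightarrow> \<exists>!t. is_star S s t"

definition star :: "'a sgrp \<Rightarrow> 'a \<Rightarrow> 'a" where
  "star S s = (THE t. is_star S s t)"

definition idempotents :: "'a sgrp \<Rightarrow> 'a set" where
  "idempotents S = {e \<in> carrier S. e \<cdot>\<^bsub>S\<^esub> e = e}"

definition idem_sgrp :: "'a sgrp \<Rightarrow> 'a sgrp" where
  "idem_sgrp S = \<lparr>carrier = idempotents S, sprod = sprod S\<rparr>"

text \<open>Homomorphisms are extensional, so that two of them are equal as soon as they agree
  on the carrier of the source.\<close>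

definition sgrp_hom :: "'a sgrp \<Rightarrow> 'b sgrp \<Rightarrow> ('a \<Rightarrow> 'b) set" where
  "sgrp_hom S T =
     {f \<in> carrier S \<rightarrow>\<^sub>E carrier T.
        \<forall>s\<in>carrier S. \<forall>t\<in>carrier S. f (s \<cdot>\<^bsub>S\<^esub> t) = f s \<cdot>\<^bsub>T\<^esub> f t}"

definition circle_zero :: "complex sgrp" where
  "circle_zero = \<lparr>carrier = {z. cmod z = 1} \<union> {0}, sprod = (*)\<rparr>"

definition zero_one :: "nat sgrp" where
  "zero_one = \<lparr>carrier = {0, 1}, sprod = (*)\<rparr>"

definition dual :: "'a sgrp \<Rightarrow> ('a \<Rightarrow> complex) set" where
  "dual S = sgrp_hom S circle_zero"

definition nu_ab :: "'a sgrp \<Rightarrow> ('a \<times> 'a) set" where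
  "nu_ab S = {(s, t). s \<in> carrier S \<and> t \<in> carrier S \<and> (\<forall>\<phi>\<in>dual S. \<phi> s = \<phi> t)}"

text \<open>As for quotients in \<^theory>\<open>HOL.Equiv_Relations\<close>, operations on classes are unions over
  representatives; for a congruence all members of the union are equal.\<close>

definition quotient_sgrp :: "'a sgrp \<Rightarrow> ('a \<times> 'a) set \<Rightarrow> 'a set sgrp" where
  "quotient_sgrp S R =
     \<lparr>carrier = carrier S // R,
      sprod = \<lambda>A B. \<Union>s\<in>A. \<Union>t\<in>B. R `` {s \<cdot>\<^bsub>S\<^esub> t}\<rparr>"

definition sgrp_ab :: "'a sgrp \<Rightarrow> 'a set sgrp" where
  "sgrp_ab S = quotient_sgrp S (nu_ab S)"


section \<open>Topological groupoids and their abelianization\<close>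

text \<open>The set of arrows is the underlying set of the topology, and units are arrows, so that the
  unit space carries the relative topology.  The value of \<open>gcomp\<close> at \<open>\<alpha>\<close>, \<open>\<beta>\<close> is meaningful
  only if \<open>\<alpha>\<close>, \<open>\<beta>\<close> are arrows with \<open>gdom \<alpha> = gran \<beta>\<close>.\<close>

record 'a groupoid =
  gtop :: "'a topology"
  gdom :: "'a \<Rightarrow> 'a"
  gran :: "'a \<Rightarrow> 'a"
  gcomp :: "'a \<Rightarrow> 'a \<Rightarrow> 'a"
  ginv :: "'a \<Rightarrow> 'a"

abbreviation arrows :: "'a groupoid \<Rightarrow> 'a set" where
  "arrows G \<equiv> topspace (gtop G)"

definition units :: "'a groupoid \<Rightarrow> 'a set" where
  "units G = gdom G ` arrows G"

definition groupoid_isomorphism :: "'a groupoid \<Rightarrow> 'b groupoid \<Rightarrow> ('a \<Rightarrow> 'b) \<Rightarrow> bool" where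
  "groupoid_isomorphism G H f \<longleftrightarrow>
     homeomorphic_map (gtop G) (gtop H) f \<and>
     (\<forall>\<alpha>\<in>arrows G. f (gdom G \<alpha>) = gdom H (f \<alpha>) \<and> f (gran G \<alpha>) = gran H (f \<alpha>) \<and>
        f (ginv G \<alpha>) = ginv H (f \<alpha>)) \<and>
     (\<forall>\<alpha>\<in>arrows G. \<forall>\<beta>\<in>arrows G. gdom G \<alpha> = gran G \<beta> \<longrightarrow>
        f (gcomp G \<alpha> \<beta>) = gcomp H (f \<alpha>) (f \<beta>))"

definition groupoid_isomorphic :: "'a groupoid \<Rightarrow> 'b groupoid \<Rightarrow> bool" where
  "groupoid_isomorphic G H \<longleftrightarrow> (\<exists>f. groupoid_isomorphism G H f)"

definition quotient_topology :: "'a topology \<Rightarrow> ('a \<times> 'a) set \<Rightarrow> 'a set topology" where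
  "quotient_topology X R =
     topology (\<lambda>U. U \<subseteq> topspace X // R \<and> openin X {x \<in> topspace X. R `` {x} \<in> U})"

lemma openin_quotient_topology:
  "openin (quotient_topology X R) U \<longleftrightarrow>
     U \<subseteq> topspace X // R \<and> openin X {x \<in> topspace X. R `` {x} \<in> U}"
proof -
  have "istopology (\<lambda>U. U \<subseteq> topspace X // R \<and> openin X {x \<in> topspace X. R `` {x} \<in> U})"
    unfolding istopology_def
  proof (intro conjI allI impI)
    fix U V
    assume U: "U \<subseteq> topspace X // R \<and> openin X {x \<in> topspace X. R `` {x} \<in> U}"
      and V: "V \<subseteq> topspace X // R \<and> openin X {x \<in> topspace X. R `` {x} \<in> V}"
    show "U \<inter> V \<subseteq> topspace X // R" using U by blast
    have "{x \<in> topspace X. R `` {x} \<in> U \<inter> V} =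
        {x \<in> topspace X. R `` {x} \<in> U} \<inter> {x \<in> topspace X. R `` {x} \<in> V}" by blast
    then show "openin X {x \<in> topspace X. R `` {x} \<in> U \<inter> V}" using U V by auto
  next
    fix \<U>
    assume U: "\<forall>U\<in>\<U>. U \<subseteq> topspace X // R \<and> openin X {x \<in> topspace X. R `` {x} \<in> U}"
    show "\<Union>\<U> \<subseteq> topspace X // R" using U by blast
    have "{x \<in> topspace X. R `` {x} \<in> \<Union>\<U>} = (\<Union>U\<in>\<U>. {x \<in> topspace X. R `` {x} \<in> U})" by blast
    then show "openin X {x \<in> topspace X. R `` {x} \<in> \<Union>\<U>}" using U by auto
  qed
  then show ?thesis by (simp add: quotient_topology_def topology_inverse')
qed

definition quotient_rel :: "'a groupoid \<Rightarrow> 'a set \<Rightarrow> ('a \<times> 'a) set" where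
  "quotient_rel G H =
     {(\<alpha>, \<beta>). \<alpha> \<in> arrows G \<and> \<beta> \<in> arrows G \<and> gdom G \<alpha> = gdom G \<beta> \<and> gcomp G \<alpha> (ginv G \<beta>) \<in> H}"

definition quotient_groupoid :: "'a groupoid \<Rightarrow> 'a set \<Rightarrow> 'a set groupoid" where
  "quotient_groupoid G H =
     (let R = quotient_rel G H in
      \<lparr>gtop = quotient_topology (gtop G) R,
       gdom = \<lambda>A. \<Union>\<alpha>\<in>A. R `` {gdom G \<alpha>},
       gran = \<lambda>A. \<Union>\<alpha>\<in>A. R `` {gran G \<alpha>},
       gcomp = \<lambda>A B. \<Union>\<alpha>\<in>A. \<Union>\<beta>\<in>{\<beta> \<in> B. gdom G \<alpha> = gran G \<beta>}. R `` {gcomp G \<alpha> \<beta>},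
       ginv = \<lambda>A. \<Union>\<alpha>\<in>A. R `` {ginv G \<alpha>}\<rparr>)"

definition fixed_points :: "'a groupoid \<Rightarrow> 'a set" where
  "fixed_points G = {x \<in> units G. \<forall>\<alpha>\<in>arrows G. gdom G \<alpha> = x \<longrightarrow> gran G \<alpha> = x}"

definition fix_groupoid :: "'a groupoid \<Rightarrow> 'a groupoid" where
  "fix_groupoid G =
     G\<lparr>gtop := subtopology (gtop G) {\<alpha> \<in> arrows G. gdom G \<alpha> \<in> fixed_points G}\<rparr>"

definition fibre_group :: "'a groupoid \<Rightarrow> 'a \<Rightarrow> 'a monoid" where
  "fibre_group G x =
     \<lparr>carrier = {\<alpha> \<in> arrows G. gdom G \<alpha> = x}, mult = gcomp G, one = x\<rparr>"

definition fix_commutators :: "'a groupoid \<Rightarrow> 'a set" where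
  "fix_commutators G =
     (\<Union>x\<in>fixed_points G.
        derived (fibre_group (fix_groupoid G) x) (carrier (fibre_group (fix_groupoid G) x)))"

definition groupoid_ab :: "'a groupoid \<Rightarrow> 'a set groupoid" where
  "groupoid_ab G = quotient_groupoid (fix_groupoid G) (fix_commutators G)"


section \<open>The universal groupoid of an inverse semigroup\<close>

definition idem_dual :: "'a sgrp \<Rightarrow> ('a \<Rightarrow> nat) set" where
  "idem_dual S = {\<xi> \<in> sgrp_hom (idem_sgrp S) zero_one. \<exists>e\<in>idempotents S. \<xi> e \<noteq> 0}"

definition idem_dual_top :: "'a sgrp \<Rightarrow> ('a \<Rightarrow> nat) topology" where
  "idem_dual_top S =
     subtopology (product_topology (\<lambda>_. discrete_topology {0, 1}) (idempotents S)) (idem_dual S)"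

definition Dset :: "'a sgrp \<Rightarrow> 'a \<Rightarrow> ('a \<Rightarrow> nat) set" where
  "Dset S e = {\<xi> \<in> idem_dual S. \<xi> e = 1}"

definition beta :: "'a sgrp \<Rightarrow> 'a \<Rightarrow> ('a \<Rightarrow> nat) \<Rightarrow> ('a \<Rightarrow> nat)" where
  "beta S s \<xi> = (\<lambda>e\<in>idempotents S. \<xi> (star S s \<cdot>\<^bsub>S\<^esub> e \<cdot>\<^bsub>S\<^esub> s))"

definition germ_pairs :: "'a sgrp \<Rightarrow> ('a \<times> ('a \<Rightarrow> nat)) set" where
  "germ_pairs S = {(s, \<xi>). s \<in> carrier S \<and> \<xi> \<in> Dset S (star S s \<cdot>\<^bsub>S\<^esub> s)}"

definition germ_rel :: "'a sgrp \<Rightarrow> (('a \<times> ('a \<Rightarrow> nat)) \<times> ('a \<times> ('a \<Rightarrow> nat))) set" where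
  "germ_rel S =
     {((s, \<xi>), (t, \<eta>)). (s, \<xi>) \<in> germ_pairs S \<and> (t, \<eta>) \<in> germ_pairs S \<and> \<xi> = \<eta> \<and>
        (\<exists>e\<in>idempotents S. \<xi> e = 1 \<and> s \<cdot>\<^bsub>S\<^esub> e = t \<cdot>\<^bsub>S\<^esub> e)}"

definition germ :: "'a sgrp \<Rightarrow> 'a \<Rightarrow> ('a \<Rightarrow> nat) \<Rightarrow> ('a \<times> ('a \<Rightarrow> nat)) set" where
  "germ S s \<xi> = germ_rel S `` {(s, \<xi>)}"

text \<open>The unit corresponding to \<open>\<xi>\<close>: the common value of \<open>germ S e \<xi>\<close> for all idempotents \<open>e\<close>
  with \<open>\<xi> e = 1\<close>.\<close>

definition unit_germ :: "'a sgrp \<Rightarrow> ('a \<Rightarrow> nat) \<Rightarrow> ('a \<times> ('a \<Rightarrow> nat)) set" where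
  "unit_germ S \<xi> = (\<Union>e\<in>{e \<in> idempotents S. \<xi> e = 1}. germ S e \<xi>)"

definition universal_groupoid :: "'a sgrp \<Rightarrow> ('a \<times> ('a \<Rightarrow> nat)) set groupoid" where
  "universal_groupoid S =
     \<lparr>gtop = topology_generated_by
        {germ S s ` U |s U. s \<in> carrier S \<and> openin (idem_dual_top S) U \<and>
           U \<subseteq> Dset S (star S s \<cdot>\<^bsub>S\<^esub> s)},
      gdom = \<lambda>A. \<Union>(s, \<xi>)\<in>A. unit_germ S \<xi>,
      gran = \<lambda>A. \<Union>(s, \<xi>)\<in>A. unit_germ S (beta S s \<xi>),
      gcomp = \<lambda>A B. \<Union>(s, \<eta>)\<in>A. \<Union>(t, \<xi>)\<in>{(t, \<xi>) \<in> B. \<eta> = beta S t \<xi>}. germ S (s \<cdot>\<^bsub>S\<^esub> t) \<xi>,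
      ginv = \<lambda>A. \<Union>(s, \<xi>)\<in>A. germ S (star S s) (beta S s \<xi>)\<rparr>"

end

theory Submission
  imports Defs
begin

text \<open>Writing \<open>s'\<close> for the inverse of \<open>s\<close>: a unit \<open>\<xi>\<close> of \<open>G_u(S)\<close> is a fixed point iff
  \<open>\<xi>(s's) = \<xi>(ss')\<close> for all \<open>s\<close>, and then \<open>s \<mapsto> \<xi>(s's)\<close> is a homomorphism on all of \<open>S\<close>.  Hence
  such \<open>\<xi>\<close> are constant on the classes of \<open>nu_ab\<close>, and descending them gives a homeomorphism from the
  fixed points onto the unit space of \<open>G_u(S^ab)\<close>.  So mapping \<open>[s, \<xi>]\<close> to the germ of the class
  of \<open>s\<close> at the descended \<open>\<xi>\<close> is an open surjective groupoid homomorphism from \<open>G_u(S)_fix\<close>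
  onto \<open>G_u(S^ab)\<close>.  It identifies arrows exactly modulo commutators: the isotropy groups of
  \<open>G_u(S^ab)\<close> are abelian, so commutators are killed; conversely, a character of the isotropy group
  at \<open>\<xi>\<close>, extended by \<open>0\<close> to those \<open>s\<close> with \<open>\<xi>(s's) = 0\<close>, is an element of the dual of \<open>S\<close>, and the
  characters of a group separate the points of its abelianization because the circle is divisible.\<close>

section \<open>Characters of abelian groups\<close>

text \<open>The two sides are abelianized in different ways. Equality in \<open>sgrp_ab S\<close> is
  global, tested by homomorphisms on the whole of S, whereas \<open>groupoid_ab\<close> divides each
  isotropy group by its own commutators. So a character known only on the germs at one unit \<xi>
  has to be turned into a homomorphism on all of S. Extension by 0 is multiplicative exactly because
  s \<mapsto> \<xi>(s's) is; conversely, multiplicativity of this map forces \<xi>(s's) =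
  \<xi>(s')\<xi>(s) = \<xi>(ss') in the evident sense, which is why only fixed units survive
  abelianization. The map between the groupoids is defined before dividing by commutators, where
  arrows still have representatives in S. Once it is known to be a quotient map for the topologies
  and its kernel is known, the isomorphism is formal, and the topology of the quotient is reached
  only through this map.\<close>

text \<open>Characters of a subgroup are represented by their graphs, so that the union of a chain
  of extensions is again such an object.\<close>

definition partial_character :: "('a, 'b) monoid_scheme \<Rightarrow> ('a \<times> complex) set \<Rightarrow> bool" where
  "partial_character A R \<longleftrightarrow>
     R \<subseteq> carrier A \<times> {z. cmod z = 1} \<and> (\<one>\<^bsub>A\<^esub>, 1) \<in> R \<and>
     (\<forall>x z y w. (x, z) \<in> R \<longrightarrow> (y, w) \<in> R \<longrightarrow> (x \<otimes>\<^bsub>A\<^esub> y, z * w) \<in> R) \<and>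
     (\<forall>x z. (x, z) \<in> R \<longrightarrow> (inv\<^bsub>A\<^esub> x, inverse z) \<in> R) \<and>
     (\<forall>z. (\<one>\<^bsub>A\<^esub>, z) \<in> R \<longrightarrow> z = 1)"

context comm_group
begin

lemma partial_characterD:
  assumes "partial_character G R"
  shows "(x, z) \<in> R \<Longrightarrow> x \<in> carrier G" "(x, z) \<in> R \<Longrightarrow> cmod z = 1" "(\<one>, 1) \<in> R"
    "(x, z) \<in> R \<Longrightarrow> (y, w) \<in> R \<Longrightarrow> (x \<otimes> y, z * w) \<in> R"
    "(x, z) \<in> R \<Longrightarrow> (inv x, inverse z) \<in> R" "(\<one>, z) \<in> R \<Longrightarrow> z = 1"
  using assms unfolding partial_character_def by blast+

text \<open>Dividing two values at x gives a value at the neutral element. Together with closure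
  under products and inverses, the last clause of \<open>partial_character\<close> thus makes the
  relation single-valued.\<close>

lemma partial_character_unique:
  assumes R: "partial_character G R" and z: "(x, z) \<in> R" and w: "(x, w) \<in> R"
  shows "z = w"
proof -
  have "(x \<otimes> inv x, z * inverse w) \<in> R"
    using partial_characterD[OF R] z w by blast
  then have "z * inverse w = 1"
    using partial_characterD(1,6)[OF R] z by simp
  then show ?thesis
    using right_inverse_eq by (metis divide_inverse inverse_zero mult_zero_right zero_neq_one)
qed

lemma partial_character_int_pow:
  assumes R: "partial_character G R" and z: "(x, z) \<in> R"
  shows "(x [^] (k::int), z powi k) \<in> R"
proof -
  have nat: "(x [^] (n::nat), z ^ n) \<in> R" for n
  proof (induction n)
    case 0
    show ?case using partial_characterD(3)[OF R] by simp
  next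
    case (Suc n)
    show ?case using partial_characterD(4)[OF R Suc.IH z] by (simp add: mult.commute)
  qed
  have x: "x \<in> carrier G" using partial_characterD(1)[OF R] z .
  show ?thesis
  proof (cases "k \<ge> 0")
    case True
    then obtain n where "k = int n" using nonneg_int_cases by blast
    then show ?thesis using nat[of n] by (simp add: int_pow_int)
  next
    case False
    then obtain n where "k = - int n" by (cases k rule: int_cases2) auto
    then show ?thesis
      using partial_characterD(5)[OF R nat[of n]] x
      by (simp add: int_pow_neg int_pow_int power_int_minus)
  qed
qed

text \<open>On the subgroup generated by the domain and \<open>a\<close>, the value at
  \<open>h \<otimes> a [^] k\<close> has to be \<open>z * w powi k\<close>. This is well defined by
  \<open>compat\<close>: if \<open>h \<otimes> a [^] k\<close> is neutral, then
  \<open>a [^] k\<close> is the inverse of h and already has a prescribed value.\<close>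

lemma partial_character_extend:
  assumes R: "partial_character G R" and a: "a \<in> carrier G" and w: "cmod w = 1"
    and compat: "\<And>k z. (a [^] (k::int), z) \<in> R \<Longrightarrow> z = w powi k"
  shows "\<exists>R'. partial_character G R' \<and> R \<subseteq> R' \<and> (a, w) \<in> R'"
proof (intro exI conjI)
  note D = partial_characterD[OF R]
  define R' where "R' = {(h \<otimes> a [^] (k::int), z * w powi k) | h k z. (h, z) \<in> R}"
  have w0: "w \<noteq> 0" using w by auto
  have I: "(h \<otimes> a [^] k, z * w powi k) \<in> R'" if "(h, z) \<in> R" for h z and k :: int
    using that unfolding R'_def by blast
  show "R \<subseteq> R'"
    using I[where k = 0] D(1) a by fastforce
  show "(a, w) \<in> R'"
    using I[OF D(3), of 1] a by simp
  show "partial_character G R'"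
    unfolding partial_character_def
  proof (intro conjI allI impI)
    show "R' \<subseteq> carrier G \<times> {z. cmod z = 1}"
      using D(1,2) a w unfolding R'_def by (auto simp: norm_mult norm_power_int)
    show "(\<one>, 1) \<in> R'" using \<open>R \<subseteq> R'\<close> D(3) by blast
  next
    fix x z y v assume "(x, z) \<in> R'" "(y, v) \<in> R'"
    then obtain h k c h' l c' where e: "x = h \<otimes> a [^] (k::int)" "z = c * w powi k" "(h, c) \<in> R"
      "y = h' \<otimes> a [^] (l::int)" "v = c' * w powi l" "(h', c') \<in> R"
      unfolding R'_def by blast
    have c: "h \<in> carrier G" "h' \<in> carrier G" "a [^] k \<in> carrier G" "a [^] l \<in> carrier G"
      using D(1) e a by auto
    have "x \<otimes> y = (h \<otimes> h') \<otimes> a [^] (k + l)"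
      using c a unfolding e by (simp add: int_pow_mult m_ac)
    moreover have "z * v = (c * c') * w powi (k + l)"
      using w0 unfolding e by (simp add: power_int_add)
    ultimately show "(x \<otimes> y, z * v) \<in> R'" using I[OF D(4)[OF e(3,6)]] by simp
  next
    fix x z assume "(x, z) \<in> R'"
    then obtain h k c where e: "x = h \<otimes> a [^] (k::int)" "z = c * w powi k" "(h, c) \<in> R"
      unfolding R'_def by blast
    have c: "h \<in> carrier G" "a [^] k \<in> carrier G" using D(1) e a by auto
    have "inv x = inv h \<otimes> a [^] (- k)"
      using c a unfolding e by (simp add: int_pow_neg inv_mult)
    moreover have "inverse z = inverse c * w powi (- k)"
      unfolding e by (simp add: power_int_minus)
    ultimately show "(inv x, inverse z) \<in> R'" using I[OF D(5)[OF e(3)]] by simp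
  next
    fix z assume "(\<one>, z) \<in> R'"
    then obtain h k c where e: "\<one> = h \<otimes> a [^] (k::int)" "z = c * w powi k" "(h, c) \<in> R"
      unfolding R'_def by blast
    have c: "h \<in> carrier G" "a [^] k \<in> carrier G" using D(1) e a by auto
    have "a [^] k \<otimes> h = \<one>" using e(1) c m_comm by simp
    then have "inv h = a [^] k" using c by (intro inv_equality)
    then have w: "w powi k = inverse c" using D(5)[OF e(3)] compat[of k "inverse c"] by simp
    have "c \<noteq> 0" using D(2)[OF e(3)] by auto
    then show "z = 1" unfolding e(2) w by simp
  qed
qed

text \<open>Divisibility of the circle enters here. The exponents k with \<open>a [^] k\<close> in
  the domain form a subgroup of the integers. If it is trivial, every w is compatible; if n
  generates it, w has to be an n-th root of the value at \<open>a [^] n\<close>. The last conjunct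
  later separates \<open>a\<close> from the neutral element.\<close>

lemma partial_character_root:
  assumes R: "partial_character G R" and a: "a \<in> carrier G"
  shows "\<exists>w. cmod w = 1 \<and> (\<forall>k z. (a [^] (k::int), z) \<in> R \<longrightarrow> z = w powi k) \<and>
    (a \<notin> Domain R \<longrightarrow> w \<noteq> 1)"
proof (cases "\<exists>n>0. a [^] int n \<in> Domain R")
  case False
  have "k = 0" if "(a [^] (k::int), z) \<in> R" for k z
  proof (rule ccontr)
    assume "k \<noteq> 0"
    then consider n where "n > 0" "k = int n" | n where "n > 0" "k = - int n"
      by (cases k rule: int_cases3) auto
    then show False
    proof cases
      case 1 then show False using that False by blast
    next
      case 2
      then have "(a [^] int n, inverse z) \<in> R"
        using partial_characterD(5)[OF R that] a by (simp add: int_pow_neg)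
      then show False using 2 False by blast
    qed
  qed
  then have "z = (-1) powi k" if "(a [^] (k::int), z) \<in> R" for k z
    using that partial_characterD(6)[OF R] by fastforce
  \<comment> \<open>Any complex number of modulus 1 other than 1 would do.\<close>
  then show ?thesis by (intro exI[of _ "-1"]) simp
next
  case True
  define n where "n = (LEAST n. n > 0 \<and> a [^] int n \<in> Domain R)"
  have n: "n > 0" "a [^] int n \<in> Domain R"
    using LeastI_ex[OF True] unfolding n_def by auto
  have min: "m = 0" if "m < n" "a [^] int m \<in> Domain R" for m
    using that not_less_Least[of m "\<lambda>n. n > 0 \<and> a [^] int n \<in> Domain R"]
    unfolding n_def by auto
  obtain u where u: "(a [^] int n, u) \<in> R" using n(2) by blast
  have u1: "cmod u = 1" using partial_characterD(2)[OF R u] .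
  \<comment> \<open>For u = 1 the root has to avoid 1, so a primitive root of unity is taken; for
    any other u no root can be 1.\<close>
  obtain w where w: "w ^ n = u" "cmod w = 1" "n \<ge> 2 \<Longrightarrow> w \<noteq> 1"
  proof (cases "u = 1")
    case True
    have "cis (2 * pi / n) \<noteq> 1" if "n \<ge> 2"
    proof
      assume "cis (2 * pi / n) = 1"
      \<comment> \<open>Comparing real parts suffices: for n \<ge> 2 the angle lies in [0, pi],
        where the cosine is injective.\<close>
      then have "Re (cis (2 * pi / n)) = Re 1" by (rule arg_cong)
      then have "cos (2 * pi / n) = cos 0" by simp
      moreover have "0 \<le> 2 * pi / n" "2 * pi / n \<le> pi"
        using that by (auto simp: field_simps)
      ultimately have "2 * pi / n = 0" 
        using cos_inj_pi[of "2 * pi / n" 0] by simp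
      then show False using that by simp
    qed
    moreover have "cis (2 * pi / n) ^ n = u"
    proof -
      have e: "real n * (2 * pi / n) = 2 * pi" using n(1) by simp
      show ?thesis unfolding Complex.DeMoivre e True by (simp add: complex_eq_iff)
    qed
    ultimately show thesis using that[of "cis (2 * pi / n)"] by simp
  next
    case False
    have "cis (Arg u / n) ^ n = u"
    proof -
      have "u \<noteq> 0" using u1 by auto
      then have "cis (Arg u) = u" using u1 by (simp add: cis_Arg sgn_eq)
      moreover have e: "real n * (Arg u / n) = Arg u" using n(1) by simp
      ultimately show ?thesis unfolding Complex.DeMoivre e by simp
    qed
    moreover from this have "cis (Arg u / n) \<noteq> 1" using False by auto
    ultimately show thesis using that[of "cis (Arg u / n)"] by simp
  qed
  show ?thesis
  proof (intro exI conjI allI impI)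
    show "cmod w = 1" by fact
    show "w \<noteq> 1" if "a \<notin> Domain R"
    proof -
      have "n \<noteq> 1" using that n a by (auto simp: int_pow_int)
      then show ?thesis using w(3) n(1) by linarith
    qed
  next
    fix k z assume kz: "(a [^] (k::int), z) \<in> R"
    \<comment> \<open>Division with remainder: the power of \<open>a\<close> to the remainder is
      again in the domain, and the remainder is below the minimal n, hence 0.\<close>
    define m where "m = k div int n"
    have mul: "a [^] (int n * m) = (a [^] int n) [^] m"
      using a by (simp add: int_pow_pow)
    have um: "(a [^] (int n * m), u powi m) \<in> R"
      using partial_character_int_pow[OF R u] mul by simp
    have "a [^] k \<otimes> inv (a [^] (int n * m)) = a [^] (k - int n * m)"
      using a by (simp add: int_pow_diff)
    also have "k - int n * m = int (nat (k mod int n))"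
      using n(1) by (simp add: m_def minus_mult_div_eq_mod)
    finally have "a [^] int (nat (k mod int n)) \<in> Domain R"
      using partial_characterD(4,5)[OF R] kz um by (metis DomainI)
    moreover have "nat (k mod int n) < n" using n(1) by (simp add: nat_less_iff)
    ultimately have "nat (k mod int n) = 0" using min by blast
    moreover have "k mod int n \<ge> 0" using n(1) by simp
    ultimately have "k mod int n = 0" by simp
    then have k: "k = int n * m" using mult_div_mod_eq[of "int n" k] unfolding m_def by simp
    then have "z = u powi m" using partial_character_unique[OF R] kz um by blast
    also have "\<dots> = w powi k" using w(1) k by (simp add: power_int_mult)
    finally show "z = w powi k" .
  qed
qed

text \<open>Zorn's lemma: a maximal partial character is total, since
  \<open>partial_character_root\<close> and \<open>partial_character_extend\<close> would extend it
  to any missing element.\<close>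

theorem character_separates:
  assumes a: "a \<in> carrier G" "a \<noteq> \<one>"
  obtains \<phi> where "\<And>x. x \<in> carrier G \<Longrightarrow> cmod (\<phi> x) = 1"
    "\<And>x y. x \<in> carrier G \<Longrightarrow> y \<in> carrier G \<Longrightarrow> \<phi> (x \<otimes> y) = \<phi> x * \<phi> y" "\<phi> a \<noteq> 1"
proof -
  have triv: "partial_character G {(\<one>, 1)}"
    unfolding partial_character_def by auto
  obtain w where w: "cmod w = 1" "\<And>k z. (a [^] (k::int), z) \<in> {(\<one>, 1)} \<Longrightarrow> z = w powi k" "w \<noteq> 1"
    using partial_character_root[OF triv a(1)] a(2) by blast
  obtain R0 where R0: "partial_character G R0" "(a, w) \<in> R0"
    using partial_character_extend[OF triv a(1) w(1,2)] by blast
  \<comment> \<open>Maximality is sought above \<open>R0\<close>, so that the value w \<noteq> 1 at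
    \<open>a\<close> is kept.\<close>
  define \<A> where "\<A> = {R. partial_character G R \<and> R0 \<subseteq> R}"
  have "\<exists>M\<in>\<A>. \<forall>X\<in>\<A>. M \<subseteq> X \<longrightarrow> X = M"
  proof (rule subset_Zorn_nonempty)
    show "\<A> \<noteq> {}" using R0(1) unfolding \<A>_def by blast
    fix \<C> assume ne: "\<C> \<noteq> {}" and ch: "subset.chain \<A> \<C>"
    have sub: "\<And>X. X \<in> \<C> \<Longrightarrow> partial_character G X \<and> R0 \<subseteq> X"
      using ch unfolding subset.chain_def \<A>_def by blast
    \<comment> \<open>Closure under products involves two pairs at once; in a chain they lie in a
      common member.\<close>
    have two: "\<exists>Z\<in>\<C>. p \<in> Z \<and> q \<in> Z" if pq: "p \<in> \<Union>\<C>" "q \<in> \<Union>\<C>" for p q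
    proof -
      obtain X Y where XY: "X \<in> \<C>" "p \<in> X" "Y \<in> \<C>" "q \<in> Y" using pq by blast
      then have "X \<subseteq> Y \<or> Y \<subseteq> X" using ch unfolding subset_chain_def by blast
      then show ?thesis using XY by blast
    qed
    have "partial_character G (\<Union>\<C>)"
      unfolding partial_character_def
    proof (intro conjI allI impI)
      show "\<Union>\<C> \<subseteq> carrier G \<times> {z. cmod z = 1}"
        using sub partial_characterD(1,2) by fast
      show "(\<one>, 1) \<in> \<Union>\<C>" using ne sub partial_characterD(3) by blast
      show "(x \<otimes> y, z * w) \<in> \<Union>\<C>" if "(x, z) \<in> \<Union>\<C>" "(y, w) \<in> \<Union>\<C>" for x y z w
        using two[OF that] sub partial_characterD(4) by blast
      show "(inv x, inverse z) \<in> \<Union>\<C>" if "(x, z) \<in> \<Union>\<C>" for x z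
        using that sub partial_characterD(5) by blast
      show "z = 1" if "(\<one>, z) \<in> \<Union>\<C>" for z
        using that sub partial_characterD(6) by blast
    qed
    then show "\<Union>\<C> \<in> \<A>" using ne sub unfolding \<A>_def by blast
  qed
  then obtain M where MA: "M \<in> \<A>" and maxA: "\<forall>X\<in>\<A>. M \<subseteq> X \<longrightarrow> X = M" by blast
  have M: "partial_character G M" "R0 \<subseteq> M" using MA unfolding \<A>_def by auto
  have max: "X = M" if "partial_character G X" "M \<subseteq> X" for X
    using that M(2) maxA unfolding \<A>_def by simp
  have total: "\<exists>z. (x, z) \<in> M" if x: "x \<in> carrier G" for x
  proof -
    obtain v where v: "cmod v = 1" "\<And>k z. (x [^] (k::int), z) \<in> M \<Longrightarrow> z = v powi k"
      using partial_character_root[OF M(1) x] by blast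
    obtain X where "partial_character G X" "M \<subseteq> X" "(x, v) \<in> X"
      using partial_character_extend[OF M(1) x v] by blast
    then show ?thesis using max by blast
  qed
  define \<phi> where "\<phi> x = (SOME z. (x, z) \<in> M)" for x
  have \<phi>: "(x, \<phi> x) \<in> M" if "x \<in> carrier G" for x
    unfolding \<phi>_def using total[OF that] by (rule someI_ex)
  show thesis
  proof
    show "cmod (\<phi> x) = 1" if "x \<in> carrier G" for x
      using partial_characterD(2)[OF M(1) \<phi>[OF that]] .
    show "\<phi> (x \<otimes> y) = \<phi> x * \<phi> y" if "x \<in> carrier G" "y \<in> carrier G" for x y
      using partial_character_unique[OF M(1) \<phi>[OF m_closed[OF that]]
          partial_characterD(4)[OF M(1) \<phi>[OF that(1)] \<phi>[OF that(2)]]] .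
    show "\<phi> a \<noteq> 1"
      using partial_character_unique[OF M(1) \<phi>[OF a(1)]] R0(2) M(2) w(3) by blast
  qed
qed

end

text \<open>A character of the abelian quotient by the derived subgroup is pulled back; the coset of
  \<open>a\<close> is not neutral there because \<open>a\<close> lies outside that subgroup.\<close>

lemma (in group) character_separates_from_derived:
  assumes a: "a \<in> carrier G" "a \<notin> derived G (carrier G)"
  obtains \<phi> where "\<And>x. x \<in> carrier G \<Longrightarrow> cmod (\<phi> x) = 1"
    "\<And>x y. x \<in> carrier G \<Longrightarrow> y \<in> carrier G \<Longrightarrow> \<phi> (x \<otimes> y) = \<phi> x * \<phi> y" "\<phi> a \<noteq> 1"
proof -
  define D where "D = derived G (carrier G)"
  have D: "D \<lhd> G" unfolding D_def by (rule derived_self_is_normal)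
  interpret Q: comm_group "G Mod D" unfolding D_def by (rule derived_quot_is_comm_group)
  have hom: "(\<lambda>x. D #> x) \<in> hom G (G Mod D)" using normal.r_coset_hom_Mod[OF D] .
  have "D #> a \<noteq> D"
    using a(2) rcos_self[OF a(1) normal_imp_subgroup[OF D]] D_def by blast
  then have ne: "D #> a \<noteq> \<one>\<^bsub>G Mod D\<^esub>" by (simp add: FactGroup_def)
  have im: "x \<in> carrier G \<Longrightarrow> D #> x \<in> carrier (G Mod D)" for x
    using hom unfolding hom_def by blast
  obtain \<phi> where \<phi>: "\<And>x. x \<in> carrier (G Mod D) \<Longrightarrow> cmod (\<phi> x) = 1"
    "\<And>x y. x \<in> carrier (G Mod D) \<Longrightarrow> y \<in> carrier (G Mod D) \<Longrightarrow> \<phi> (x \<otimes>\<^bsub>G Mod D\<^esub> y) = \<phi> x * \<phi> y"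
    "\<phi> (D #> a) \<noteq> 1"
    using Q.character_separates[OF im[OF a(1)] ne] by metis
  show thesis
    by (rule that[of "\<lambda>x. \<phi> (D #> x)"]) (use \<phi> im hom_mult[OF hom] in auto)
qed

section \<open>Inverse semigroups\<close>

context inverse_semigroup
begin

abbreviation star_sup (\<open>_\<^sup>\<star>\<close> [1000] 999) where "s\<^sup>\<star> \<equiv> star S s"

lemma star_props:
  assumes "s \<in> carrier S"
  shows "s\<^sup>\<star> \<in> carrier S" "s \<cdot> s\<^sup>\<star> \<cdot> s = s" "s\<^sup>\<star> \<cdot> s \<cdot> s\<^sup>\<star> = s\<^sup>\<star>"
proof -
  have "is_star S s (s\<^sup>\<star>)"
    unfolding star_def by (rule theI'[OF ex1_star[OF assms]])
  then show "s\<^sup>\<star> \<in> carrier S" "s \<cdot> s\<^sup>\<star> \<cdot> s = s" "s\<^sup>\<star> \<cdot> s \<cdot> s\<^sup>\<star> = s\<^sup>\<star>"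
    unfolding is_star_def by auto
qed

declare closed [simp] star_props(1) [simp]

lemma star_right [simp]: "s \<in> carrier S \<Longrightarrow> s \<cdot> (s\<^sup>\<star> \<cdot> s) = s"
  and star_left [simp]: "s \<in> carrier S \<Longrightarrow> s\<^sup>\<star> \<cdot> (s \<cdot> s\<^sup>\<star>) = s\<^sup>\<star>"
  using star_props[of s] by (simp_all add: assoc)

text \<open>Words are normalized by bracketing to the right. The trailing factor t lets
  \<open>simp\<close> cancel in the middle of a longer word.\<close>

lemma star_right' [simp]: "\<lbrakk>s \<in> carrier S; t \<in> carrier S\<rbrakk> \<Longrightarrow> s \<cdot> (s\<^sup>\<star> \<cdot> (s \<cdot> t)) = s \<cdot> t"
  and star_left' [simp]: "\<lbrakk>s \<in> carrier S; t \<in> carrier S\<rbrakk> \<Longrightarrow> s\<^sup>\<star> \<cdot> (s \<cdot> (s\<^sup>\<star> \<cdot> t)) = s\<^sup>\<star> \<cdot> t"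
  using star_props[of s] by (simp_all flip: assoc)

lemma star_eqI:
  assumes "s \<in> carrier S" "t \<in> carrier S" "s \<cdot> (t \<cdot> s) = s" "t \<cdot> (s \<cdot> t) = t"
  shows "s\<^sup>\<star> = t"
proof -
  have "is_star S s t" using assms by (simp add: is_star_def assoc)
  moreover have "is_star S s (s\<^sup>\<star>)" using assms(1) by (simp add: is_star_def assoc)
  ultimately show ?thesis using ex1_star[OF assms(1)] by blast
qed

lemma star_star [simp]: "s \<in> carrier S \<Longrightarrow> (s\<^sup>\<star>)\<^sup>\<star> = s"
  by (rule star_eqI) simp_all

lemma idempotentsI: "\<lbrakk>e \<in> carrier S; e \<cdot> e = e\<rbrakk> \<Longrightarrow> e \<in> idempotents S"
  by (simp add: idempotents_def)

lemma idempotentsD [simp]: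
  "e \<in> idempotents S \<Longrightarrow> e \<in> carrier S" "e \<in> idempotents S \<Longrightarrow> e \<cdot> e = e"
  by (simp_all add: idempotents_def)

lemma idempotents_square [simp]: "\<lbrakk>e \<in> idempotents S; s \<in> carrier S\<rbrakk> \<Longrightarrow> e \<cdot> (e \<cdot> s) = e \<cdot> s"
  by (simp flip: assoc)

lemma star_idempotent [simp]: "e \<in> idempotents S \<Longrightarrow> e\<^sup>\<star> = e"
  by (rule star_eqI) simp_all

text \<open>With x the inverse of \<open>e \<cdot> f\<close>, the element
  \<open>f \<cdot> (x \<cdot> e)\<close> is an inverse as well, so uniqueness gives
  \<open>x = f \<cdot> (x \<cdot> e)\<close>. This form makes x idempotent, hence its own inverse,
  and \<open>e \<cdot> f\<close>, being the inverse of x, equals x.\<close>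

lemma idempotents_product:
  assumes e: "e \<in> idempotents S" and f: "f \<in> idempotents S"
  shows "e \<cdot> f \<in> idempotents S"
proof -
  define x where "x = (e \<cdot> f)\<^sup>\<star>"
  have c: "e \<in> carrier S" "f \<in> carrier S" "x \<in> carrier S" using e f unfolding x_def by auto
  have x1: "e \<cdot> (f \<cdot> (x \<cdot> (e \<cdot> f))) = e \<cdot> f" and x2: "x \<cdot> (e \<cdot> (f \<cdot> x)) = x"
    using star_props(2,3)[of "e \<cdot> f"] c by (simp_all add: assoc flip: x_def)
  have x2': "x \<cdot> (e \<cdot> (f \<cdot> (x \<cdot> t))) = x \<cdot> t" if "t \<in> carrier S" for t
  proof -
    have "x \<cdot> (e \<cdot> (f \<cdot> (x \<cdot> t))) = (x \<cdot> (e \<cdot> (f \<cdot> x))) \<cdot> t" using c that by (simp add: assoc)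
    then show ?thesis using x2 by simp
  qed
  have "(e \<cdot> f)\<^sup>\<star> = f \<cdot> (x \<cdot> e)"
    by (rule star_eqI) (use c e f x1 x2' in \<open>simp_all add: assoc\<close>)
  then have x: "x = f \<cdot> (x \<cdot> e)" unfolding x_def .
  have "x \<cdot> x = (f \<cdot> (x \<cdot> e)) \<cdot> (f \<cdot> (x \<cdot> e))" using x by simp
  also have "\<dots> = f \<cdot> (x \<cdot> e)" using c x2' by (simp add: assoc)
  also have "\<dots> = x" using x by simp
  finally have "x \<cdot> x = x" .
  then have xi: "x \<in> idempotents S" using c(3) by (intro idempotentsI)
  have "e \<cdot> f = x\<^sup>\<star>" using c unfolding x_def by simp
  also have "\<dots> = x" by (rule star_idempotent[OF xi])
  finally have ef: "e \<cdot> f = x" .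
  show ?thesis unfolding ef by (rule xi)
qed

text \<open>\<open>f \<cdot> e\<close> is an inverse of \<open>e \<cdot> f\<close>, while the
  idempotent \<open>e \<cdot> f\<close> is its own inverse.\<close>

lemma idempotents_commute:
  assumes e: "e \<in> idempotents S" and f: "f \<in> idempotents S"
  shows "e \<cdot> f = f \<cdot> e"
proof -
  have ef: "e \<cdot> f \<in> idempotents S" "f \<cdot> e \<in> idempotents S"
    using idempotents_product e f by auto
  have c: "e \<in> carrier S" "f \<in> carrier S" using e f by auto
  have 1: "e \<cdot> (f \<cdot> (e \<cdot> f)) = e \<cdot> f" "f \<cdot> (e \<cdot> (f \<cdot> e)) = f \<cdot> e"
    using idempotentsD(2)[OF ef(1)] idempotentsD(2)[OF ef(2)] c by (simp_all add: assoc)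
  have "(e \<cdot> f)\<^sup>\<star> = f \<cdot> e"
    by (rule star_eqI) (use c e f 1 in \<open>simp_all add: assoc\<close>)
  then show ?thesis using ef by simp
qed

lemma star_product_idempotent [simp]:
  assumes "s \<in> carrier S"
  shows "s\<^sup>\<star> \<cdot> s \<in> idempotents S" "s \<cdot> s\<^sup>\<star> \<in> idempotents S"
  using assms by (auto intro!: idempotentsI simp: assoc)

text \<open>The idempotents \<open>s \<cdot> s\<^sup>\<star>\<close> and
  \<open>s\<^sup>\<star> \<cdot> s\<close> commute with e. Read from right to left, the first
  equation moves e across s at the price of conjugating it.\<close>

lemma idempotent_shift:
  assumes s: "s \<in> carrier S" and e: "e \<in> idempotents S"
  shows "s \<cdot> (s\<^sup>\<star> \<cdot> (e \<cdot> s)) = e \<cdot> s" "e \<cdot> (s\<^sup>\<star> \<cdot> s) = s\<^sup>\<star> \<cdot> (s \<cdot> e)"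
proof -
  have "(s \<cdot> s\<^sup>\<star>) \<cdot> e = e \<cdot> (s \<cdot> s\<^sup>\<star>)" "e \<cdot> (s\<^sup>\<star> \<cdot> s) = (s\<^sup>\<star> \<cdot> s) \<cdot> e"
    using idempotents_commute e s by simp_all
  then have "s \<cdot> s\<^sup>\<star> \<cdot> e \<cdot> s = e \<cdot> (s \<cdot> s\<^sup>\<star>) \<cdot> s" and 2: "e \<cdot> (s\<^sup>\<star> \<cdot> s) = (s\<^sup>\<star> \<cdot> s) \<cdot> e"
    by simp_all
  then show "s \<cdot> (s\<^sup>\<star> \<cdot> (e \<cdot> s)) = e \<cdot> s" using s e by (simp add: assoc)
  show "e \<cdot> (s\<^sup>\<star> \<cdot> s) = s\<^sup>\<star> \<cdot> (s \<cdot> e)" using 2 s e by (simp add: assoc)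
qed

lemma idempotent_shift':
  assumes s: "s \<in> carrier S" and e: "e \<in> idempotents S" and t: "t \<in> carrier S"
  shows "s \<cdot> (s\<^sup>\<star> \<cdot> (e \<cdot> (s \<cdot> t))) = e \<cdot> (s \<cdot> t)"
proof -
  have "s \<cdot> (s\<^sup>\<star> \<cdot> (e \<cdot> (s \<cdot> t))) = (s \<cdot> (s\<^sup>\<star> \<cdot> (e \<cdot> s))) \<cdot> t"
    using assms by (simp add: assoc)
  also have "\<dots> = e \<cdot> (s \<cdot> t)" using assms by (simp add: idempotent_shift assoc)
  finally show ?thesis .
qed

lemma conjugate_idempotent [simp]:
  assumes s: "s \<in> carrier S" and e: "e \<in> idempotents S"
  shows "s\<^sup>\<star> \<cdot> (e \<cdot> s) \<in> idempotents S"
  by (rule idempotentsI) (use assms in \<open>simp_all add: assoc idempotent_shift\<close>)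

text \<open>The verification rests on \<open>s\<^sup>\<star> \<cdot> s\<close> commuting with
  \<open>t \<cdot> t\<^sup>\<star>\<close>, which enters through
  \<open>idempotent_shift\<close>.\<close>

lemma star_product:
  assumes s: "s \<in> carrier S" and t: "t \<in> carrier S"
  shows "(s \<cdot> t)\<^sup>\<star> = t\<^sup>\<star> \<cdot> s\<^sup>\<star>"
proof (rule star_eqI)
  have 1: "t \<cdot> (t\<^sup>\<star> \<cdot> (s\<^sup>\<star> \<cdot> (s \<cdot> t))) = s\<^sup>\<star> \<cdot> (s \<cdot> t)"
    using idempotent_shift(1)[OF t star_product_idempotent(1)[OF s]] s t by (simp add: assoc)
  show "s \<cdot> t \<cdot> (t\<^sup>\<star> \<cdot> s\<^sup>\<star> \<cdot> (s \<cdot> t)) = s \<cdot> t"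
    using s t 1 by (simp add: assoc)
  have 2: "s\<^sup>\<star> \<cdot> (s \<cdot> (t \<cdot> (t\<^sup>\<star> \<cdot> s\<^sup>\<star>))) = t \<cdot> (t\<^sup>\<star> \<cdot> s\<^sup>\<star>)"
    using idempotent_shift(1)[of "s\<^sup>\<star>" "t \<cdot> t\<^sup>\<star>"] s t by (simp add: assoc)
  show "t\<^sup>\<star> \<cdot> s\<^sup>\<star> \<cdot> (s \<cdot> t \<cdot> (t\<^sup>\<star> \<cdot> s\<^sup>\<star>)) = t\<^sup>\<star> \<cdot> s\<^sup>\<star>"
    using s t 2 by (simp add: assoc)
qed (use s t in simp_all)

section \<open>Semicharacters of the idempotents and the partial action on them\<close>

lemma idem_dualD:
  assumes "\<xi> \<in> idem_dual S"
  shows "e \<in> idempotents S \<Longrightarrow> \<xi> e = 0 \<or> \<xi> e = 1"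
    "\<lbrakk>e \<in> idempotents S; f \<in> idempotents S\<rbrakk> \<Longrightarrow> \<xi> (e \<cdot> f) = \<xi> e * \<xi> f"
    "\<xi> \<in> extensional (idempotents S)" "\<exists>e\<in>idempotents S. \<xi> e = 1"
proof -
  have h: "\<xi> \<in> idempotents S \<rightarrow>\<^sub>E {0, 1}"
    "\<forall>s\<in>idempotents S. \<forall>t\<in>idempotents S. \<xi> (s \<cdot> t) = \<xi> s * \<xi> t" "\<exists>e\<in>idempotents S. \<xi> e \<noteq> 0"
    using assms unfolding idem_dual_def sgrp_hom_def idem_sgrp_def zero_one_def by auto
  show 1: "\<xi> e = 0 \<or> \<xi> e = 1" if "e \<in> idempotents S" for e using h(1) that by (auto simp: PiE_iff)
  show "\<lbrakk>e \<in> idempotents S; f \<in> idempotents S\<rbrakk> \<Longrightarrow> \<xi> (e \<cdot> f) = \<xi> e * \<xi> f" using h(2) by blast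
  show "\<xi> \<in> extensional (idempotents S)" using h(1) by (simp add: PiE_iff)
  show "\<exists>e\<in>idempotents S. \<xi> e = 1" using h(3) 1 by force
qed

lemma idem_dualI:
  assumes "\<And>e. e \<in> idempotents S \<Longrightarrow> \<xi> e = 0 \<or> \<xi> e = 1"
    "\<And>e f. \<lbrakk>e \<in> idempotents S; f \<in> idempotents S\<rbrakk> \<Longrightarrow> \<xi> (e \<cdot> f) = \<xi> e * \<xi> f"
    "\<xi> \<in> extensional (idempotents S)" "e \<in> idempotents S" "\<xi> e = 1"
  shows "\<xi> \<in> idem_dual S"
  using assms unfolding idem_dual_def sgrp_hom_def idem_sgrp_def zero_one_def
  by (auto simp: PiE_iff intro!: bexI[of _ e])

lemma beta_apply: "\<lbrakk>s \<in> carrier S; e \<in> idempotents S\<rbrakk> \<Longrightarrow> beta S s \<xi> e = \<xi> (s\<^sup>\<star> \<cdot> (e \<cdot> s))"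
  by (simp add: beta_def assoc)

lemma germ_pairs_iff:
  "(s, \<xi>) \<in> germ_pairs S \<longleftrightarrow> s \<in> carrier S \<and> \<xi> \<in> idem_dual S \<and> \<xi> (s\<^sup>\<star> \<cdot> s) = 1"
  by (auto simp: germ_pairs_def Dset_def)

text \<open>Conjugation by s is multiplicative on idempotents, because they commute with
  \<open>s \<cdot> s\<^sup>\<star>\<close>; the value 1 at this idempotent shows that the new
  semicharacter is nonzero.\<close>

lemma beta_idem_dual:
  assumes "(s, \<xi>) \<in> germ_pairs S"
  shows "beta S s \<xi> \<in> idem_dual S" "beta S s \<xi> (s \<cdot> s\<^sup>\<star>) = 1"
proof -
  have s: "s \<in> carrier S" and \<xi>: "\<xi> \<in> idem_dual S" and 1: "\<xi> (s\<^sup>\<star> \<cdot> s) = 1"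
    using assms unfolding germ_pairs_iff by auto
  show 2: "beta S s \<xi> (s \<cdot> s\<^sup>\<star>) = 1" using s 1 by (simp add: beta_apply assoc)
  show "beta S s \<xi> \<in> idem_dual S"
  proof (rule idem_dualI)
    show "beta S s \<xi> e = 0 \<or> beta S s \<xi> e = 1" if "e \<in> idempotents S" for e
      using idem_dualD(1)[OF \<xi> conjugate_idempotent[OF s that]] s that by (simp add: beta_apply)
    show "beta S s \<xi> (e \<cdot> f) = beta S s \<xi> e * beta S s \<xi> f"
      if e: "e \<in> idempotents S" and f: "f \<in> idempotents S" for e f
    proof -
      have "(s\<^sup>\<star> \<cdot> (e \<cdot> s)) \<cdot> (s\<^sup>\<star> \<cdot> (f \<cdot> s)) = s\<^sup>\<star> \<cdot> (e \<cdot> f \<cdot> s)"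
        using s e f by (simp add: assoc idempotent_shift)
      then show ?thesis
        using idem_dualD(2)[OF \<xi> conjugate_idempotent[OF s e] conjugate_idempotent[OF s f]] s e f
        by (simp add: beta_apply idempotents_product)
    qed
    show "beta S s \<xi> \<in> extensional (idempotents S)" by (simp add: beta_def)
    show "s \<cdot> s\<^sup>\<star> \<in> idempotents S" using s by simp
  qed (fact 2)
qed

lemma beta_product:
  assumes "s \<in> carrier S" "t \<in> carrier S"
  shows "beta S s (beta S t \<xi>) = beta S (s \<cdot> t) \<xi>"
proof
  fix e show "beta S s (beta S t \<xi>) e = beta S (s \<cdot> t) \<xi> e"
  proof (cases "e \<in> idempotents S")
    case True
    then show ?thesis using assms by (simp add: beta_apply star_product assoc)
  next
    case False then show ?thesis by (simp add: beta_def)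
  qed
qed

lemma beta_idempotent:
  assumes \<xi>: "\<xi> \<in> idem_dual S" and e: "e \<in> idempotents S" "\<xi> e = 1"
  shows "beta S e \<xi> = \<xi>"
proof
  fix f show "beta S e \<xi> f = \<xi> f"
  proof (cases "f \<in> idempotents S")
    case True
    then show ?thesis
      using e idem_dualD(2)[OF \<xi>] by (simp add: beta_apply idempotents_product)
  next
    case False then show ?thesis using idem_dualD(3)[OF \<xi>] by (simp add: beta_def extensional_def)
  qed
qed

lemma germ_pairs_product:
  assumes t: "(t, \<xi>) \<in> germ_pairs S" and s: "(s, beta S t \<xi>) \<in> germ_pairs S"
  shows "(s \<cdot> t, \<xi>) \<in> germ_pairs S"
  using s t by (auto simp: germ_pairs_iff beta_apply star_product assoc)

lemma germ_pairs_star: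
  assumes "(s, \<xi>) \<in> germ_pairs S"
  shows "(s\<^sup>\<star>, beta S s \<xi>) \<in> germ_pairs S" "beta S (s\<^sup>\<star>) (beta S s \<xi>) = \<xi>"
proof -
  have s: "s \<in> carrier S" "\<xi> \<in> idem_dual S" "\<xi> (s\<^sup>\<star> \<cdot> s) = 1"
    using assms unfolding germ_pairs_iff by auto
  show "(s\<^sup>\<star>, beta S s \<xi>) \<in> germ_pairs S"
    using beta_idem_dual[OF assms] s by (simp add: germ_pairs_iff)
  show "beta S (s\<^sup>\<star>) (beta S s \<xi>) = \<xi>"
    using s by (simp add: beta_product beta_idempotent)
qed

lemma germ_pairs_idempotent:
  "\<lbrakk>\<xi> \<in> idem_dual S; e \<in> idempotents S; \<xi> e = 1\<rbrakk> \<Longrightarrow> (e, \<xi>) \<in> germ_pairs S"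
  by (simp add: germ_pairs_iff)

section \<open>Germs at a fixed semicharacter\<close>

definition germ_equiv :: "('a \<Rightarrow> nat) \<Rightarrow> 'a \<Rightarrow> 'a \<Rightarrow> bool" where
  "germ_equiv \<xi> s t \<longleftrightarrow> (\<exists>e\<in>idempotents S. \<xi> e = 1 \<and> s \<cdot> e = t \<cdot> e)"

lemma germ_equiv_refl: "\<xi> \<in> idem_dual S \<Longrightarrow> germ_equiv \<xi> s s"
  using idem_dualD(4) unfolding germ_equiv_def by blast

lemma germ_equiv_sym: "germ_equiv \<xi> s t \<Longrightarrow> germ_equiv \<xi> t s"
  unfolding germ_equiv_def by metis

text \<open>Since idempotents commute, the product of the two witnesses serves for both
  equations.\<close>

lemma germ_equiv_trans:
  assumes \<xi>: "\<xi> \<in> idem_dual S" and c: "s \<in> carrier S" "t \<in> carrier S" "u \<in> carrier S"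
    and st: "germ_equiv \<xi> s t" and tu: "germ_equiv \<xi> t u"
  shows "germ_equiv \<xi> s u"
proof -
  obtain e f where e: "e \<in> idempotents S" "\<xi> e = 1" "s \<cdot> e = t \<cdot> e"
    and f: "f \<in> idempotents S" "\<xi> f = 1" "t \<cdot> f = u \<cdot> f"
    using st tu unfolding germ_equiv_def by blast
  have ef: "e \<cdot> f \<in> idempotents S" using e f idempotents_product by blast
  have com: "e \<cdot> f = f \<cdot> e" using e f idempotents_commute by blast
  have "s \<cdot> (e \<cdot> f) = s \<cdot> e \<cdot> f" using c e(1) f(1) by (simp add: assoc)
  also have "\<dots> = t \<cdot> (f \<cdot> e)" using c e(1) f(1) unfolding e(3) by (simp add: assoc com)
  also have "\<dots> = t \<cdot> f \<cdot> e" using c e(1) f(1) by (simp add: assoc)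
  also have "\<dots> = u \<cdot> (e \<cdot> f)" using c e(1) f(1) unfolding f(3) by (simp add: assoc com)
  finally show ?thesis
    using ef idem_dualD(2)[OF \<xi> e(1) f(1)] e f unfolding germ_equiv_def by auto
qed

lemma germ_iff:
  assumes "(s, \<xi>) \<in> germ_pairs S"
  shows "p \<in> germ S s \<xi> \<longleftrightarrow> (\<exists>t. p = (t, \<xi>) \<and> (t, \<xi>) \<in> germ_pairs S \<and> germ_equiv \<xi> s t)"
  using assms by (cases p) (auto simp: germ_def germ_rel_def germ_equiv_def)

lemma germ_self: "(s, \<xi>) \<in> germ_pairs S \<Longrightarrow> (s, \<xi>) \<in> germ S s \<xi>"
  by (simp add: germ_iff germ_equiv_refl germ_pairs_iff)

lemma germ_eq_iff:
  assumes s: "(s, \<xi>) \<in> germ_pairs S" and t: "(t, \<eta>) \<in> germ_pairs S"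
  shows "germ S s \<xi> = germ S t \<eta> \<longleftrightarrow> \<xi> = \<eta> \<and> germ_equiv \<xi> s t"
proof
  assume "germ S s \<xi> = germ S t \<eta>"
  then have "(t, \<eta>) \<in> germ S s \<xi>" using germ_self[OF t] by simp
  then show "\<xi> = \<eta> \<and> germ_equiv \<xi> s t" using germ_iff[OF s] by simp
next
  assume *: "\<xi> = \<eta> \<and> germ_equiv \<xi> s t"
  have "germ_equiv \<xi> s u \<longleftrightarrow> germ_equiv \<eta> t u" if "u \<in> carrier S" for u
    using germ_equiv_trans[of \<xi>] germ_equiv_sym * s t that unfolding germ_pairs_iff by meson
  then show "germ S s \<xi> = germ S t \<eta>"
    using * germ_iff[OF s] germ_iff[OF t] by (auto simp: germ_pairs_iff)
qed

text \<open>The product \<open>e \<cdot> f\<close> absorbs both factors, so it is a witness. This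
  makes the union in \<open>unit_germ\<close> a single germ.\<close>

lemma idempotents_germ_equiv:
  assumes \<xi>: "\<xi> \<in> idem_dual S" and e: "e \<in> idempotents S" "\<xi> e = 1" and f: "f \<in> idempotents S" "\<xi> f = 1"
  shows "germ_equiv \<xi> e f"
proof -
  have "f \<cdot> (e \<cdot> f) = f \<cdot> (f \<cdot> e)" using idempotents_commute[OF e(1) f(1)] by simp
  also have "\<dots> = f \<cdot> e" using e(1) f(1) by simp
  also have "\<dots> = e \<cdot> f" using idempotents_commute[OF e(1) f(1)] by simp
  also have "\<dots> = e \<cdot> (e \<cdot> f)" using e(1) f(1) by simp
  finally have "e \<cdot> (e \<cdot> f) = f \<cdot> (e \<cdot> f)" by simp
  then show ?thesis
    unfolding germ_equiv_def using idem_dualD(2)[OF \<xi> e(1) f(1)] e f idempotents_product by force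
qed

lemma unit_germ_eq:
  assumes \<xi>: "\<xi> \<in> idem_dual S" and e: "e \<in> idempotents S" "\<xi> e = 1"
  shows "unit_germ S \<xi> = germ S e \<xi>"
proof -
  have "germ S f \<xi> = germ S e \<xi>" if "f \<in> idempotents S" "\<xi> f = 1" for f
    using germ_eq_iff germ_pairs_idempotent[OF \<xi>] idempotents_germ_equiv[OF \<xi>] e that by metis
  then show ?thesis unfolding unit_germ_def using e by blast
qed

text \<open>For a witness e the map \<open>beta S e\<close> fixes \<xi>, so s may be replaced by
  \<open>s \<cdot> e\<close>, which is the same element for s and t.\<close>

lemma germ_equiv_beta:
  assumes s: "(s, \<xi>) \<in> germ_pairs S" and t: "(t, \<xi>) \<in> germ_pairs S" and st: "germ_equiv \<xi> s t"
  shows "beta S s \<xi> = beta S t \<xi>"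
proof -
  obtain e where e: "e \<in> idempotents S" "\<xi> e = 1" "s \<cdot> e = t \<cdot> e"
    using st unfolding germ_equiv_def by blast
  have "beta S s \<xi> = beta S (s \<cdot> e) \<xi>" if "(s, \<xi>) \<in> germ_pairs S" for s
  proof -
    have "beta S e \<xi> = \<xi>" using that e by (simp add: germ_pairs_iff beta_idempotent)
    then show ?thesis using beta_product[of s e \<xi>] that e by (simp add: germ_pairs_iff)
  qed
  then show ?thesis using s t e(3) by metis
qed

lemma germ_equiv_product:
  assumes t: "(t, \<xi>) \<in> germ_pairs S" "(t', \<xi>) \<in> germ_pairs S" "germ_equiv \<xi> t t'"
    and s: "(s, beta S t \<xi>) \<in> germ_pairs S" "(s', beta S t \<xi>) \<in> germ_pairs S"
      "germ_equiv (beta S t \<xi>) s s'"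
  shows "germ_equiv \<xi> (s \<cdot> t) (s' \<cdot> t')"
proof -
  obtain e f where e: "e \<in> idempotents S" "beta S t \<xi> e = 1" "s \<cdot> e = s' \<cdot> e"
    and f: "f \<in> idempotents S" "\<xi> f = 1" "t \<cdot> f = t' \<cdot> f"
    using s t unfolding germ_equiv_def by blast
  have c: "s \<in> carrier S" "s' \<in> carrier S" "t \<in> carrier S" "t' \<in> carrier S"
      "e \<in> carrier S" "f \<in> carrier S" and \<xi>: "\<xi> \<in> idem_dual S"
    using s t e f unfolding germ_pairs_iff by auto
  \<comment> \<open>The witness \<open>e\<close> for s and s' belongs to the range of t. Conjugation
    brings it back to \<xi>, and \<open>t \<cdot> g = e \<cdot> t\<close>.\<close>
  define g where "g = t\<^sup>\<star> \<cdot> (e \<cdot> t)"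
  have g: "g \<in> idempotents S" unfolding g_def using c e by simp
  have "\<xi> g = 1" using e c unfolding g_def by (simp add: beta_apply)
  then have 1: "\<xi> (f \<cdot> g) = 1" "f \<cdot> g \<in> idempotents S"
    using idem_dualD(2)[OF \<xi> f(1) g] f g idempotents_product by simp_all
  have fg: "f \<cdot> g = g \<cdot> f" using idempotents_commute f g by blast
  have tg: "t \<cdot> (f \<cdot> g) = e \<cdot> (t \<cdot> f)"
    unfolding fg using c e by (simp add: g_def assoc idempotent_shift')
  have "s \<cdot> t \<cdot> (f \<cdot> g) = s \<cdot> (t \<cdot> (f \<cdot> g))" using c g by (simp add: assoc)
  also have "\<dots> = s \<cdot> e \<cdot> (t \<cdot> f)" unfolding tg using c by (simp add: assoc)
  also have "\<dots> = s' \<cdot> (e \<cdot> (t \<cdot> f))" unfolding e(3) using c by (simp add: assoc)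
  also have "\<dots> = s' \<cdot> (t \<cdot> f \<cdot> g)" unfolding tg[symmetric] using c g by (simp add: assoc)
  also have "\<dots> = s' \<cdot> t' \<cdot> (f \<cdot> g)" unfolding f(3) using c g by (simp add: assoc)
  finally show ?thesis unfolding germ_equiv_def using 1 by blast
qed

lemma germ_equiv_star:
  assumes s: "(s, \<xi>) \<in> germ_pairs S" and t: "(t, \<xi>) \<in> germ_pairs S" and st: "germ_equiv \<xi> s t"
  shows "germ_equiv (beta S s \<xi>) (s\<^sup>\<star>) (t\<^sup>\<star>)"
proof -
  obtain e where e: "e \<in> idempotents S" "\<xi> e = 1" "s \<cdot> e = t \<cdot> e"
    using st unfolding germ_equiv_def by blast
  have c: "s \<in> carrier S" "t \<in> carrier S" "e \<in> carrier S" and \<xi>: "\<xi> \<in> idem_dual S" "\<xi> (s\<^sup>\<star> \<cdot> s) = 1"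
    using s t e unfolding germ_pairs_iff by auto
  \<comment> \<open>Here the witness has to be carried forward, from \<xi> to
    \<open>beta S s \<xi>\<close>.\<close>
  define g where "g = s \<cdot> (e \<cdot> s\<^sup>\<star>)"
  have g: "g \<in> idempotents S" unfolding g_def
    using conjugate_idempotent[of "s\<^sup>\<star>" e] c e by simp
  \<comment> \<open>Taking inverses in \<open>s \<cdot> e = t \<cdot> e\<close> puts the idempotent
    on the left.\<close>
  have es: "e \<cdot> s\<^sup>\<star> = e \<cdot> t\<^sup>\<star>"
    using arg_cong[OF e(3), of "star S"] c e(1) by (simp add: star_product)
  have sg: "u\<^sup>\<star> \<cdot> (u \<cdot> (e \<cdot> u\<^sup>\<star>)) = e \<cdot> u\<^sup>\<star>" if "u \<in> carrier S" for u
    using idempotent_shift(1)[of "u\<^sup>\<star>" e] that e by simp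
  have "t\<^sup>\<star> \<cdot> g = t\<^sup>\<star> \<cdot> ((s \<cdot> e) \<cdot> (s\<^sup>\<star>))" unfolding g_def using c by (simp add: assoc)
  also have "\<dots> = t\<^sup>\<star> \<cdot> (t \<cdot> (e \<cdot> s\<^sup>\<star>))" unfolding e(3) using c by (simp add: assoc)
  also have "\<dots> = e \<cdot> s\<^sup>\<star>" unfolding es using sg c by simp
  also have "\<dots> = s\<^sup>\<star> \<cdot> g" unfolding g_def using sg c by simp
  finally have "s\<^sup>\<star> \<cdot> g = t\<^sup>\<star> \<cdot> g" by simp
  moreover have "beta S s \<xi> g = 1"
  proof -
    have "s\<^sup>\<star> \<cdot> (g \<cdot> s) = (s\<^sup>\<star> \<cdot> s) \<cdot> (e \<cdot> (s\<^sup>\<star> \<cdot> s))" unfolding g_def using c by (simp add: assoc)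
    moreover have "e \<cdot> (s\<^sup>\<star> \<cdot> s) \<in> idempotents S" using idempotents_product e c by simp
    ultimately show ?thesis
      using idem_dualD(2)[OF \<xi>(1)] \<xi>(2) e c g by (simp add: beta_apply)
  qed
  ultimately show ?thesis unfolding germ_equiv_def using g by blast
qed

end

section \<open>The universal groupoid\<close>

context inverse_semigroup
begin

section \<open>Structure maps on representatives\<close>

lemma gdom_germ:
  assumes "(s, \<xi>) \<in> germ_pairs S"
  shows "gdom (universal_groupoid S) (germ S s \<xi>) = unit_germ S \<xi>"
  using germ_self[OF assms] germ_iff[OF assms] by (fastforce simp: universal_groupoid_def)

lemma gran_germ:
  assumes s: "(s, \<xi>) \<in> germ_pairs S"
  shows "gran (universal_groupoid S) (germ S s \<xi>) = unit_germ S (beta S s \<xi>)"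
proof -
  have "(case p of (t, \<eta>) \<Rightarrow> unit_germ S (beta S t \<eta>)) = unit_germ S (beta S s \<xi>)"
    if "p \<in> germ S s \<xi>" for p
    using that germ_equiv_beta[OF s] unfolding germ_iff[OF s] by auto
  then show ?thesis using germ_self[OF s] by (auto simp: universal_groupoid_def)
qed

lemma ginv_germ:
  assumes s: "(s, \<xi>) \<in> germ_pairs S"
  shows "ginv (universal_groupoid S) (germ S s \<xi>) = germ S (s\<^sup>\<star>) (beta S s \<xi>)"
proof -
  have "(case p of (t, \<eta>) \<Rightarrow> germ S (t\<^sup>\<star>) (beta S t \<eta>)) = germ S (s\<^sup>\<star>) (beta S s \<xi>)"
    if "p \<in> germ S s \<xi>" for p
  proof -
    obtain t where t: "p = (t, \<xi>)" "(t, \<xi>) \<in> germ_pairs S" "germ_equiv \<xi> s t"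
      using \<open>p \<in> germ S s \<xi>\<close> germ_iff[OF s] by blast
    have b: "beta S t \<xi> = beta S s \<xi>" using germ_equiv_beta[OF s t(2,3)] by simp
    have "germ S (s\<^sup>\<star>) (beta S s \<xi>) = germ S (t\<^sup>\<star>) (beta S t \<xi>)"
      unfolding germ_eq_iff[OF germ_pairs_star(1)[OF s] germ_pairs_star(1)[OF t(2)]]
      using b germ_equiv_star[OF s t(2,3)] by simp
    then show ?thesis using t(1) by simp
  qed
  then show ?thesis using germ_self[OF s] by (auto simp: universal_groupoid_def)
qed

lemma gcomp_germ:
  assumes t: "(t, \<xi>) \<in> germ_pairs S" and s: "(s, beta S t \<xi>) \<in> germ_pairs S"
  shows "gcomp (universal_groupoid S) (germ S s (beta S t \<xi>)) (germ S t \<xi>) = germ S (s \<cdot> t) \<xi>"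
proof -
  have eq: "germ S (s' \<cdot> t') \<xi>' = germ S (s \<cdot> t) \<xi>"
    if p: "(s', \<eta>) \<in> germ S s (beta S t \<xi>)" and q: "(t', \<xi>') \<in> germ S t \<xi>" for s' \<eta> t' \<xi>'
  proof -
    have t': "\<xi>' = \<xi>" "(t', \<xi>) \<in> germ_pairs S" "germ_equiv \<xi> t t'"
      using q germ_iff[OF t] by auto
    have s': "(s', beta S t \<xi>) \<in> germ_pairs S" "germ_equiv (beta S t \<xi>) s s'"
      using p germ_iff[OF s] by auto
    have "(s' \<cdot> t', \<xi>) \<in> germ_pairs S"
      using germ_pairs_product[OF t'(2)] s'(1) germ_equiv_beta[OF t t'(2,3)] by simp
    moreover have "germ_equiv \<xi> (s \<cdot> t) (s' \<cdot> t')"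
      using germ_equiv_product[OF t t'(2,3) s s'] .
    ultimately show ?thesis
      using germ_eq_iff[OF germ_pairs_product[OF t s]] t'(1) by auto
  qed
  have "gcomp (universal_groupoid S) (germ S s (beta S t \<xi>)) (germ S t \<xi>) =
    (\<Union>(s', \<eta>)\<in>germ S s (beta S t \<xi>). \<Union>(t', \<xi>')\<in>{(t', \<xi>') \<in> germ S t \<xi>. \<eta> = beta S t' \<xi>'}.
      germ S (s' \<cdot> t') \<xi>')"
    by (simp add: universal_groupoid_def)
  also have "\<dots> = germ S (s \<cdot> t) \<xi>"
  proof
    show "(\<Union>(s', \<eta>)\<in>germ S s (beta S t \<xi>). \<Union>(t', \<xi>')\<in>{(t', \<xi>') \<in> germ S t \<xi>. \<eta> = beta S t' \<xi>'}.
      germ S (s' \<cdot> t') \<xi>') \<subseteq> germ S (s \<cdot> t) \<xi>"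
      using eq by fast
    show "germ S (s \<cdot> t) \<xi> \<subseteq> (\<Union>(s', \<eta>)\<in>germ S s (beta S t \<xi>).
      \<Union>(t', \<xi>')\<in>{(t', \<xi>') \<in> germ S t \<xi>. \<eta> = beta S t' \<xi>'}. germ S (s' \<cdot> t') \<xi>')"
      using germ_self[OF s] germ_self[OF t] by fast
  qed
  finally show ?thesis .
qed

lemma unit_germ_eq_iff:
  assumes \<xi>: "\<xi> \<in> idem_dual S" and \<eta>: "\<eta> \<in> idem_dual S"
  shows "unit_germ S \<xi> = unit_germ S \<eta> \<longleftrightarrow> \<xi> = \<eta>"
proof
  obtain e f where e: "e \<in> idempotents S" "\<xi> e = 1" and f: "f \<in> idempotents S" "\<eta> f = 1"
    using idem_dualD(4)[OF \<xi>] idem_dualD(4)[OF \<eta>] by blast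
  assume "unit_germ S \<xi> = unit_germ S \<eta>"
  then have "germ S e \<xi> = germ S f \<eta>" using unit_germ_eq \<xi> \<eta> e f by simp
  then show "\<xi> = \<eta>" using germ_eq_iff germ_pairs_idempotent \<xi> \<eta> e f by blast
qed simp

section \<open>Topologies on units and arrows\<close>

lemma topspace_idem_dual_top: "topspace (idem_dual_top S) = idem_dual S"
proof -
  have "idem_dual S \<subseteq> PiE (idempotents S) (\<lambda>_. {0, 1})"
  proof
    fix \<xi> assume "\<xi> \<in> idem_dual S"
    then show "\<xi> \<in> PiE (idempotents S) (\<lambda>_. {0, 1})"
      using idem_dualD(1,3)[of \<xi>] by (simp add: PiE_iff)
  qed
  then show ?thesis unfolding idem_dual_top_def by (simp add: Int_absorb1)
qed

lemma continuous_map_eval: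
  "e \<in> idempotents S \<Longrightarrow> continuous_map (idem_dual_top S) (discrete_topology {0, 1}) (\<lambda>\<xi>. \<xi> e)"
  unfolding idem_dual_top_def
  by (intro continuous_map_from_subtopology continuous_map_product_projection)

lemma openin_Dset: "e \<in> idempotents S \<Longrightarrow> openin (idem_dual_top S) (Dset S e)"
  using openin_continuous_map_preimage[OF continuous_map_eval, of e "{1}"]
  by (simp add: topspace_idem_dual_top Dset_def)

lemma Dset_iff: "s \<in> carrier S \<Longrightarrow> \<xi> \<in> Dset S (s\<^sup>\<star> \<cdot> s) \<longleftrightarrow> (s, \<xi>) \<in> germ_pairs S"
  by (simp add: germ_pairs_def)

lemma arrows_universal: "arrows (universal_groupoid S) = {germ S s \<xi> |s \<xi>. (s, \<xi>) \<in> germ_pairs S}"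
proof -
  have "arrows (universal_groupoid S) = \<Union>{germ S s ` U |s U. s \<in> carrier S \<and>
      openin (idem_dual_top S) U \<and> U \<subseteq> Dset S (s\<^sup>\<star> \<cdot> s)}"
    by (simp add: universal_groupoid_def topology_generated_by_topspace)
  also have "\<dots> = {germ S s \<xi> |s \<xi>. (s, \<xi>) \<in> germ_pairs S}"
  proof (intro equalityI subsetI)
    fix \<alpha> assume "\<alpha> \<in> {germ S s \<xi> |s \<xi>. (s, \<xi>) \<in> germ_pairs S}"
    then obtain s \<xi> where s: "\<alpha> = germ S s \<xi>" "s \<in> carrier S" "\<xi> \<in> Dset S (s\<^sup>\<star> \<cdot> s)"
      by (auto simp: germ_pairs_def)
    then have "\<alpha> \<in> germ S s ` Dset S (s\<^sup>\<star> \<cdot> s)" by blast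
    then show "\<alpha> \<in> \<Union>{germ S s ` U |s U. s \<in> carrier S \<and>
      openin (idem_dual_top S) U \<and> U \<subseteq> Dset S (s\<^sup>\<star> \<cdot> s)}"
      using s(2) openin_Dset[OF star_product_idempotent(1)[OF s(2)]] by blast
  qed (auto simp: germ_pairs_def)
  finally show ?thesis .
qed

text \<open>The maps \<xi> \<mapsto> [s, \<xi>] act as charts, so openness can be tested in each of
  them. For a basic set coming from another element t this works because the charts of s and t agree
  on an open set, the union of the \<open>Dset S e\<close> over all idempotents e with
  \<open>s \<cdot> e = t \<cdot> e\<close>, intersected with their domains.\<close>

lemma openin_universal:
  "openin (gtop (universal_groupoid S)) W \<longleftrightarrow> W \<subseteq> arrows (universal_groupoid S) \<and>
     (\<forall>s\<in>carrier S. openin (idem_dual_top S) {\<xi>. (s, \<xi>) \<in> germ_pairs S \<and> germ S s \<xi> \<in> W})"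
    (is "?L W \<longleftrightarrow> ?R W")
proof
  let ?B = "{germ S s ` U |s U. s \<in> carrier S \<and> openin (idem_dual_top S) U \<and>
    U \<subseteq> Dset S (s\<^sup>\<star> \<cdot> s)}"
  have gen: "?L W \<longleftrightarrow> generate_topology_on ?B W" for W
    by (simp add: universal_groupoid_def openin_topology_generated_by_iff)
  {
    assume "?L W"
    then have "generate_topology_on ?B W" using gen by simp
    then have "openin (idem_dual_top S) {\<xi>. (s, \<xi>) \<in> germ_pairs S \<and> germ S s \<xi> \<in> W}"
      if s: "s \<in> carrier S" for s
    proof induction
      case Empty
      show ?case by simp
    next
      case (Int a b)
      have "{\<xi>. (s, \<xi>) \<in> germ_pairs S \<and> germ S s \<xi> \<in> a \<inter> b} =
        {\<xi>. (s, \<xi>) \<in> germ_pairs S \<and> germ S s \<xi> \<in> a} \<inter> {\<xi>. (s, \<xi>) \<in> germ_pairs S \<and> germ S s \<xi> \<in> b}"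
        by blast
      then show ?case using openin_Int[OF Int.IH] by simp
    next
      case (UN K)
      have "{\<xi>. (s, \<xi>) \<in> germ_pairs S \<and> germ S s \<xi> \<in> \<Union>K} =
        (\<Union>k\<in>K. {\<xi>. (s, \<xi>) \<in> germ_pairs S \<and> germ S s \<xi> \<in> k})"
        by blast
      moreover have "openin (idem_dual_top S)
          (\<Union>k\<in>K. {\<xi>. (s, \<xi>) \<in> germ_pairs S \<and> germ S s \<xi> \<in> k})"
        using UN.IH by (intro openin_Union) blast
      ultimately show ?case by simp
    next
      case (Basis b)
      then obtain t U where t: "b = germ S t ` U" "t \<in> carrier S" "openin (idem_dual_top S) U"
        "U \<subseteq> Dset S (t\<^sup>\<star> \<cdot> t)" by blast
      have "germ S s \<xi> \<in> b \<longleftrightarrow> \<xi> \<in> U \<and> (\<exists>e\<in>{e \<in> idempotents S. s \<cdot> e = t \<cdot> e}. \<xi> \<in> Dset S e)"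
        if "(s, \<xi>) \<in> germ_pairs S" for \<xi>
      proof -
        have "germ S s \<xi> = germ S t \<eta> \<longleftrightarrow> \<xi> = \<eta> \<and> germ_equiv \<xi> s t" if "\<eta> \<in> U" for \<eta>
          using that t(2,4) germ_eq_iff[OF \<open>(s, \<xi>) \<in> germ_pairs S\<close>, of t \<eta>] Dset_iff by blast
        then show ?thesis
          using \<open>(s, \<xi>) \<in> germ_pairs S\<close> unfolding t(1) germ_equiv_def Dset_def germ_pairs_iff by blast
      qed
      then have "{\<xi>. (s, \<xi>) \<in> germ_pairs S \<and> germ S s \<xi> \<in> b} =
        Dset S (s\<^sup>\<star> \<cdot> s) \<inter> U \<inter> (\<Union>e\<in>{e \<in> idempotents S. s \<cdot> e = t \<cdot> e}. Dset S e)"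
        using Dset_iff[OF s] by auto
      moreover have "openin (idem_dual_top S)
        (Dset S (s\<^sup>\<star> \<cdot> s) \<inter> U \<inter> (\<Union>e\<in>{e \<in> idempotents S. s \<cdot> e = t \<cdot> e}. Dset S e))"
        using t(3) s by (intro openin_Int openin_Union) (auto intro: openin_Dset)
      ultimately show ?case by simp
    qed
    then show "?R W" using openin_subset \<open>?L W\<close> by blast
  }
  assume R: "?R W"
  \<comment> \<open>For the converse, W is the union of the images of its slices, each of which is a
    basic open set.\<close>
  have "W = (\<Union>s\<in>carrier S. germ S s ` {\<xi>. (s, \<xi>) \<in> germ_pairs S \<and> germ S s \<xi> \<in> W})"
  proof (intro equalityI subsetI)
    fix \<alpha> assume "\<alpha> \<in> W"
    then obtain s \<xi> where "\<alpha> = germ S s \<xi>" "(s, \<xi>) \<in> germ_pairs S"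
      using R arrows_universal by auto
    then show "\<alpha> \<in> (\<Union>s\<in>carrier S. germ S s ` {\<xi>. (s, \<xi>) \<in> germ_pairs S \<and> germ S s \<xi> \<in> W})"
      using \<open>\<alpha> \<in> W\<close> by (auto simp: germ_pairs_iff)
  qed auto
  moreover have "?L (germ S s ` {\<xi>. (s, \<xi>) \<in> germ_pairs S \<and> germ S s \<xi> \<in> W})" if "s \<in> carrier S" for s
    unfolding gen
  proof (rule generate_topology_on.Basis)
    have "{\<xi>. (s, \<xi>) \<in> germ_pairs S \<and> germ S s \<xi> \<in> W} \<subseteq> Dset S (s\<^sup>\<star> \<cdot> s)"
      using Dset_iff[OF that] by blast
    then show "germ S s ` {\<xi>. (s, \<xi>) \<in> germ_pairs S \<and> germ S s \<xi> \<in> W} \<in> ?B"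
      using R that by blast
  qed
  ultimately show "?L W" by (metis (no_types, lifting) openin_Union imageE)
qed

section \<open>Fixed points of the universal groupoid\<close>

definition fixed_set :: "('a \<Rightarrow> nat) set" where
  "fixed_set = {\<xi> \<in> idem_dual S. \<forall>s\<in>carrier S. \<xi> (s\<^sup>\<star> \<cdot> s) = \<xi> (s \<cdot> s\<^sup>\<star>)}"

lemma fixed_setD: "\<xi> \<in> fixed_set \<Longrightarrow> \<xi> \<in> idem_dual S"
  by (simp add: fixed_set_def)

text \<open>The defining condition is applied to \<open>e \<cdot> s\<close> instead of s: it
  compares \<open>s\<^sup>\<star> \<cdot> (e \<cdot> s)\<close>, at which \<xi> takes the value
  \<open>beta S s \<xi> e\<close>, with \<open>e \<cdot> (s \<cdot> s\<^sup>\<star>)\<close>, at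
  which it takes the value \<open>\<xi> e\<close>.\<close>

lemma beta_fixed:
  assumes \<xi>: "\<xi> \<in> fixed_set" and s: "(s, \<xi>) \<in> germ_pairs S"
  shows "beta S s \<xi> = \<xi>"
proof
  have c: "s \<in> carrier S" "\<xi> \<in> idem_dual S" "\<xi> (s \<cdot> s\<^sup>\<star>) = 1"
    using s \<xi> unfolding germ_pairs_iff fixed_set_def by auto
  fix e show "beta S s \<xi> e = \<xi> e"
  proof (cases "e \<in> idempotents S")
    case True
    have "\<xi> ((e \<cdot> s)\<^sup>\<star> \<cdot> (e \<cdot> s)) = \<xi> ((e \<cdot> s) \<cdot> (e \<cdot> s)\<^sup>\<star>)"
      using \<xi> c True by (simp add: fixed_set_def)
    also have "(e \<cdot> s)\<^sup>\<star> \<cdot> (e \<cdot> s) = s\<^sup>\<star> \<cdot> (e \<cdot> s)" using c True by (simp add: star_product assoc)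
    also have "(e \<cdot> s) \<cdot> (e \<cdot> s)\<^sup>\<star> = e \<cdot> ((s \<cdot> s\<^sup>\<star>) \<cdot> e)" using c True by (simp add: star_product assoc)
    also have "(s \<cdot> s\<^sup>\<star>) \<cdot> e = e \<cdot> (s \<cdot> s\<^sup>\<star>)" using c True idempotents_commute by simp
    also have "e \<cdot> (e \<cdot> (s \<cdot> s\<^sup>\<star>)) = e \<cdot> (s \<cdot> s\<^sup>\<star>)" using c True by simp
    also have "\<xi> \<dots> = \<xi> e" using idem_dualD(2)[OF c(2) True] c by simp
    finally show ?thesis using c True by (simp add: beta_apply)
  next
    case False then show ?thesis using idem_dualD(3)[OF c(2)] by (simp add: beta_def extensional_def)
  qed
qed

lemma units_universal: "units (universal_groupoid S) = unit_germ S ` idem_dual S"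
proof -
  have "units (universal_groupoid S) = {unit_germ S \<xi> |s \<xi>. (s, \<xi>) \<in> germ_pairs S}"
    unfolding units_def arrows_universal using gdom_germ by force
  also have "\<dots> = unit_germ S ` idem_dual S"
    using germ_pairs_idempotent idem_dualD(4) unfolding germ_pairs_iff by blast
  finally show ?thesis .
qed

lemma fixed_points_universal: "fixed_points (universal_groupoid S) = unit_germ S ` fixed_set"
proof (intro equalityI subsetI)
  fix x assume x: "x \<in> fixed_points (universal_groupoid S)"
  then obtain \<xi> where \<xi>: "x = unit_germ S \<xi>" "\<xi> \<in> idem_dual S"
    unfolding fixed_points_def units_universal by blast
  have b: "beta S s \<xi> = \<xi>" if s: "(s, \<xi>) \<in> germ_pairs S" for s
  proof -
    have "germ S s \<xi> \<in> arrows (universal_groupoid S)" using s unfolding arrows_universal by blast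
    then have "gran (universal_groupoid S) (germ S s \<xi>) = unit_germ S \<xi>"
      using x gdom_germ[OF s] unfolding fixed_points_def \<xi>(1) by blast
    then have "unit_germ S (beta S s \<xi>) = unit_germ S \<xi>" using gran_germ[OF s] by simp
    then show ?thesis using unit_germ_eq_iff beta_idem_dual(1)[OF s] \<xi>(2) by blast
  qed
  \<comment> \<open>Invariance gives only one implication between the two values being 1. Applying
    it to the inverse of s as well gives the other, and as the values are 0 or 1 this is
    equality.\<close>
  have one: "\<xi> (s \<cdot> s\<^sup>\<star>) = 1" if "s \<in> carrier S" "\<xi> (s\<^sup>\<star> \<cdot> s) = 1" for s
    using b beta_idem_dual(2) that \<xi>(2) unfolding germ_pairs_iff by metis
  have "\<xi> (s\<^sup>\<star> \<cdot> s) = \<xi> (s \<cdot> s\<^sup>\<star>)" if s: "s \<in> carrier S" for s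
    using one[OF s] one[of "s\<^sup>\<star>"] idem_dualD(1)[OF \<xi>(2)] s star_product_idempotent[OF s]
    by (metis star_props(1) star_star)
  then show "x \<in> unit_germ S ` fixed_set" using \<xi> unfolding fixed_set_def by blast
next
  fix x assume "x \<in> unit_germ S ` fixed_set"
  then obtain \<xi> where \<xi>: "x = unit_germ S \<xi>" "\<xi> \<in> fixed_set" by blast
  have "gran (universal_groupoid S) \<alpha> = x"
    if \<alpha>: "\<alpha> \<in> arrows (universal_groupoid S)" "gdom (universal_groupoid S) \<alpha> = x" for \<alpha>
  proof -
    obtain s \<eta> where s: "\<alpha> = germ S s \<eta>" "(s, \<eta>) \<in> germ_pairs S"
      using \<alpha>(1) unfolding arrows_universal by blast
    have "unit_germ S \<eta> = unit_germ S \<xi>" using \<alpha>(2) gdom_germ[OF s(2)] s(1) \<xi>(1) by simp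
    then have "\<eta> = \<xi>" using unit_germ_eq_iff s(2) fixed_setD[OF \<xi>(2)] germ_pairs_iff by blast
    then show ?thesis using gran_germ[OF s(2)] beta_fixed[OF \<xi>(2)] s \<xi>(1) by simp
  qed
  then show "x \<in> fixed_points (universal_groupoid S)"
    unfolding fixed_points_def units_universal using \<xi> fixed_setD by blast
qed

section \<open>The groupoid over the fixed points\<close>

abbreviation fix_universal :: "('a \<times> ('a \<Rightarrow> nat)) set groupoid" where
  "fix_universal \<equiv> fix_groupoid (universal_groupoid S)"

lemma fix_groupoid_simps [simp]:
  "gdom (fix_groupoid G) = gdom G" "gran (fix_groupoid G) = gran G"
  "gcomp (fix_groupoid G) = gcomp G" "ginv (fix_groupoid G) = ginv G"
  by (simp_all add: fix_groupoid_def)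

lemma arrows_fix:
  "arrows fix_universal = {germ S s \<xi> |s \<xi>. (s, \<xi>) \<in> germ_pairs S \<and> \<xi> \<in> fixed_set}"
proof -
  have "gdom (universal_groupoid S) (germ S s \<xi>) \<in> unit_germ S ` fixed_set \<longleftrightarrow> \<xi> \<in> fixed_set"
    if "(s, \<xi>) \<in> germ_pairs S" for s \<xi>
    using that unit_germ_eq_iff fixed_setD unfolding gdom_germ[OF that] germ_pairs_iff by blast
  then have "{\<alpha> \<in> arrows (universal_groupoid S). gdom (universal_groupoid S) \<alpha> \<in> unit_germ S ` fixed_set} =
    {germ S s \<xi> |s \<xi>. (s, \<xi>) \<in> germ_pairs S \<and> \<xi> \<in> fixed_set}"
    unfolding arrows_universal by blast
  moreover have "arrows fix_universal = {\<alpha> \<in> arrows (universal_groupoid S).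
      gdom (universal_groupoid S) \<alpha> \<in> unit_germ S ` fixed_set}"
    unfolding fix_groupoid_def fixed_points_universal by auto
  ultimately show ?thesis by simp
qed

lemma germ_in_fix_iff:
  assumes s: "(s, \<xi>) \<in> germ_pairs S"
  shows "germ S s \<xi> \<in> arrows fix_universal \<longleftrightarrow> \<xi> \<in> fixed_set"
  unfolding arrows_fix using germ_eq_iff[OF s] s by blast

text \<open>This is the chart criterion of \<open>openin_universal\<close> for the relative
  topology. The work lies in the converse, where open slices over the fixed points must be extended
  to an open set of arrows over all units.\<close>

lemma openin_fix:
  "openin (gtop fix_universal) A \<longleftrightarrow> A \<subseteq> arrows fix_universal \<and>
     (\<forall>s\<in>carrier S. openin (subtopology (idem_dual_top S) fixed_set)
        {\<xi>. (s, \<xi>) \<in> germ_pairs S \<and> germ S s \<xi> \<in> A})"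
proof -
  have "gtop fix_universal = subtopology (gtop (universal_groupoid S)) (arrows fix_universal)"
    by (auto simp: fix_groupoid_def intro!: arg_cong2[where f = subtopology])
  then have top: "openin (gtop fix_universal) A \<longleftrightarrow>
      (\<exists>W. openin (gtop (universal_groupoid S)) W \<and> A = W \<inter> arrows fix_universal)" for A
    by (metis openin_subtopology)
  show ?thesis
  proof (intro iffI conjI ballI)
    assume A: "openin (gtop fix_universal) A"
    then show sub: "A \<subseteq> arrows fix_universal" using openin_subset by blast
    obtain W where W: "openin (gtop (universal_groupoid S)) W" "A = W \<inter> arrows fix_universal"
      using A[unfolded top] by (elim exE conjE) (rule that)
    fix s assume s: "s \<in> carrier S"
    have "{\<xi>. (s, \<xi>) \<in> germ_pairs S \<and> germ S s \<xi> \<in> A} =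
      {\<xi>. (s, \<xi>) \<in> germ_pairs S \<and> germ S s \<xi> \<in> W} \<inter> fixed_set"
      unfolding W(2) using germ_in_fix_iff by blast
    then show "openin (subtopology (idem_dual_top S) fixed_set)
        {\<xi>. (s, \<xi>) \<in> germ_pairs S \<and> germ S s \<xi> \<in> A}"
      using W(1) s unfolding openin_universal openin_subtopology by auto
  next
    assume A: "A \<subseteq> arrows fix_universal \<and> (\<forall>s\<in>carrier S.
      openin (subtopology (idem_dual_top S) fixed_set) {\<xi>. (s, \<xi>) \<in> germ_pairs S \<and> germ S s \<xi> \<in> A})"
    then have "\<forall>s\<in>carrier S. \<exists>V. openin (idem_dual_top S) V \<and>
        {\<xi>. (s, \<xi>) \<in> germ_pairs S \<and> germ S s \<xi> \<in> A} = V \<inter> fixed_set"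
      unfolding openin_subtopology by blast
    from bchoice[OF this] obtain V where V0: "\<forall>s\<in>carrier S. openin (idem_dual_top S) (V s) \<and>
        {\<xi>. (s, \<xi>) \<in> germ_pairs S \<and> germ S s \<xi> \<in> A} = V s \<inter> fixed_set" ..
    have V: "openin (idem_dual_top S) (V s)"
      "{\<xi>. (s, \<xi>) \<in> germ_pairs S \<and> germ S s \<xi> \<in> A} = V s \<inter> fixed_set" if "s \<in> carrier S" for s
      using bspec[OF V0 that] by simp_all
    \<comment> \<open>The extensions \<open>V s\<close> are chosen independently for different s and
      need not be compatible away from the fixed points. Over a fixed point, however,
      \<open>V s\<close> contains nothing but the slice of A, so W restricts to A.\<close>
    define W where "W = (\<Union>s\<in>carrier S. germ S s ` (V s \<inter> Dset S (s\<^sup>\<star> \<cdot> s)))"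
    have "openin (gtop (universal_groupoid S)) W"
      unfolding W_def
    proof (intro openin_Union ballI)
      fix X assume "X \<in> (\<lambda>s. germ S s ` (V s \<inter> Dset S (s\<^sup>\<star> \<cdot> s))) ` carrier S"
      then obtain s where s: "s \<in> carrier S" "X = germ S s ` (V s \<inter> Dset S (s\<^sup>\<star> \<cdot> s))" by blast
      have "openin (idem_dual_top S) (V s \<inter> Dset S (s\<^sup>\<star> \<cdot> s))"
        using V(1) openin_Dset s(1) by (simp add: openin_Int)
      then have "X \<in> {germ S s ` U |s U. s \<in> carrier S \<and> openin (idem_dual_top S) U \<and>
          U \<subseteq> Dset S (s\<^sup>\<star> \<cdot> s)}"
        using s by blast
      then show "openin (gtop (universal_groupoid S)) X"
        by (simp add: universal_groupoid_def topology_generated_by_Basis)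
    qed
    moreover have "A = W \<inter> arrows fix_universal"
    proof (intro equalityI subsetI)
      fix \<alpha> assume "\<alpha> \<in> A"
      have \<alpha>: "\<alpha> \<in> arrows fix_universal" using conjunct1[OF A] \<open>\<alpha> \<in> A\<close> by (rule subsetD)
      then obtain s \<xi> where s: "\<alpha> = germ S s \<xi>" "(s, \<xi>) \<in> germ_pairs S"
        unfolding arrows_fix by blast
      have c: "s \<in> carrier S" using s(2) germ_pairs_iff by blast
      then have "\<xi> \<in> V s" using V(2)[OF c] s \<open>\<alpha> \<in> A\<close> by blast
      then show "\<alpha> \<in> W \<inter> arrows fix_universal"
        using \<alpha> s(1) Dset_iff[OF c] s(2) c unfolding W_def by blast
    next
      fix \<alpha> assume \<alpha>: "\<alpha> \<in> W \<inter> arrows fix_universal"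
      then obtain s \<xi> where s: "\<alpha> = germ S s \<xi>" "s \<in> carrier S" "\<xi> \<in> V s" "(s, \<xi>) \<in> germ_pairs S"
        unfolding W_def using Dset_iff by blast
      then have "\<xi> \<in> fixed_set" using germ_in_fix_iff \<alpha> by blast
      then show "\<alpha> \<in> A" using V(2)[OF s(2)] s by blast
    qed
    ultimately show "openin (gtop fix_universal) A"
      unfolding top by blast
  qed
qed

lemma germ_pairs_fixed_product:
  assumes "\<xi> \<in> fixed_set" "(s, \<xi>) \<in> germ_pairs S" "(t, \<xi>) \<in> germ_pairs S"
  shows "(s \<cdot> t, \<xi>) \<in> germ_pairs S"
  using germ_pairs_product[OF assms(3)] beta_fixed assms by simp

lemma germ_pairs_fixed_star:
  assumes "\<xi> \<in> fixed_set" "(s, \<xi>) \<in> germ_pairs S"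
  shows "(s\<^sup>\<star>, \<xi>) \<in> germ_pairs S"
  using germ_pairs_star(1)[OF assms(2)] beta_fixed assms by simp

lemma gcomp_germ_fixed:
  assumes "\<xi> \<in> fixed_set" "(s, \<xi>) \<in> germ_pairs S" "(t, \<xi>) \<in> germ_pairs S"
  shows "gcomp (universal_groupoid S) (germ S s \<xi>) (germ S t \<xi>) = germ S (s \<cdot> t) \<xi>"
  using gcomp_germ[OF assms(3)] beta_fixed[OF assms(1,3)] assms by simp

lemma ginv_germ_fixed:
  assumes "\<xi> \<in> fixed_set" "(s, \<xi>) \<in> germ_pairs S"
  shows "ginv (universal_groupoid S) (germ S s \<xi>) = germ S (s\<^sup>\<star>) \<xi>"
  using ginv_germ[OF assms(2)] beta_fixed[OF assms] by simp

lemma gran_germ_fixed: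
  assumes "\<xi> \<in> fixed_set" "(s, \<xi>) \<in> germ_pairs S"
  shows "gran (universal_groupoid S) (germ S s \<xi>) = unit_germ S \<xi>"
  using gran_germ[OF assms(2)] beta_fixed[OF assms] by simp

section \<open>Isotropy groups at fixed points\<close>

abbreviation fibre :: "('a \<Rightarrow> nat) \<Rightarrow> ('a \<times> ('a \<Rightarrow> nat)) set monoid" where
  "fibre \<xi> \<equiv> fibre_group fix_universal (unit_germ S \<xi>)"

lemma fibre_carrier:
  assumes "\<xi> \<in> fixed_set"
  shows "carrier (fibre \<xi>) = {germ S s \<xi> |s. (s, \<xi>) \<in> germ_pairs S}"
proof -
  have "gdom (universal_groupoid S) (germ S s \<eta>) = unit_germ S \<xi> \<longleftrightarrow> \<eta> = \<xi>"
    if "(s, \<eta>) \<in> germ_pairs S" for s \<eta>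
    using gdom_germ[OF that] unit_germ_eq_iff that fixed_setD[OF assms] germ_pairs_iff by auto
  then show ?thesis
    unfolding fibre_group_def arrows_fix using assms by auto
qed

lemma fibre_mult: "\<alpha> \<otimes>\<^bsub>fibre \<xi>\<^esub> \<beta> = gcomp (universal_groupoid S) \<alpha> \<beta>"
  by (simp add: fibre_group_def)

lemma fibre_one: "\<one>\<^bsub>fibre \<xi>\<^esub> = unit_germ S \<xi>"
  by (simp add: fibre_group_def)

lemma fibre_is_group:
  assumes \<xi>: "\<xi> \<in> fixed_set"
  shows "group (fibre \<xi>)"
    and "(s, \<xi>) \<in> germ_pairs S \<Longrightarrow> inv\<^bsub>fibre \<xi>\<^esub> (germ S s \<xi>) = germ S (s\<^sup>\<star>) \<xi>"
proof -
  obtain e where e: "e \<in> idempotents S" "\<xi> e = 1" using idem_dualD(4) fixed_setD[OF \<xi>] by blast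
  have ep: "(e, \<xi>) \<in> germ_pairs S" using germ_pairs_idempotent fixed_setD[OF \<xi>] e by blast
  have one: "\<one>\<^bsub>fibre \<xi>\<^esub> = germ S f \<xi>" if "f \<in> idempotents S" "\<xi> f = 1" for f
    unfolding fibre_one by (rule unit_germ_eq[OF fixed_setD[OF \<xi>] that])
  have inv: "germ S (s\<^sup>\<star>) \<xi> \<otimes>\<^bsub>fibre \<xi>\<^esub> germ S s \<xi> = \<one>\<^bsub>fibre \<xi>\<^esub>" if s: "(s, \<xi>) \<in> germ_pairs S" for s
    using gcomp_germ_fixed[OF \<xi> germ_pairs_fixed_star[OF \<xi> s] s] one[of "s\<^sup>\<star> \<cdot> s"] s
    by (simp add: fibre_mult germ_pairs_iff)
  show grp: "group (fibre \<xi>)"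
  proof (rule groupI)
    fix x y z assume xyz: "x \<in> carrier (fibre \<xi>)" "y \<in> carrier (fibre \<xi>)" "z \<in> carrier (fibre \<xi>)"
    then obtain s t u where s: "x = germ S s \<xi>" "(s, \<xi>) \<in> germ_pairs S"
      and t: "y = germ S t \<xi>" "(t, \<xi>) \<in> germ_pairs S" and u: "z = germ S u \<xi>" "(u, \<xi>) \<in> germ_pairs S"
      unfolding fibre_carrier[OF \<xi>] by blast
    have "s \<cdot> t \<cdot> u = s \<cdot> (t \<cdot> u)" using s t u germ_pairs_iff assoc by blast
    then show "x \<otimes>\<^bsub>fibre \<xi>\<^esub> y \<otimes>\<^bsub>fibre \<xi>\<^esub> z = x \<otimes>\<^bsub>fibre \<xi>\<^esub> (y \<otimes>\<^bsub>fibre \<xi>\<^esub> z)"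
      using s t u \<xi> by (simp add: fibre_mult gcomp_germ_fixed germ_pairs_fixed_product)
  next
    fix x y assume "x \<in> carrier (fibre \<xi>)" "y \<in> carrier (fibre \<xi>)"
    then show "x \<otimes>\<^bsub>fibre \<xi>\<^esub> y \<in> carrier (fibre \<xi>)"
      unfolding fibre_carrier[OF \<xi>] fibre_mult
      using gcomp_germ_fixed[OF \<xi>] germ_pairs_fixed_product[OF \<xi>] by blast
  next
    show "\<one>\<^bsub>fibre \<xi>\<^esub> \<in> carrier (fibre \<xi>)"
      using ep one[OF e] unfolding fibre_carrier[OF \<xi>] by blast
  next
    fix x assume "x \<in> carrier (fibre \<xi>)"
    then obtain s where s: "x = germ S s \<xi>" "(s, \<xi>) \<in> germ_pairs S"
      unfolding fibre_carrier[OF \<xi>] by blast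
    \<comment> \<open>The unit is represented by \<open>s \<cdot> s\<^sup>\<star>\<close>, which is
      neutral for s on the left; its value is 1 because \<xi> is fixed.\<close>
    have c: "s \<in> carrier S" "\<xi> (s \<cdot> s\<^sup>\<star>) = 1"
      using s(2) \<xi> unfolding germ_pairs_iff fixed_set_def by auto
    have "(s \<cdot> s\<^sup>\<star>, \<xi>) \<in> germ_pairs S" using germ_pairs_idempotent[OF fixed_setD[OF \<xi>]] c by simp
    then have "germ S (s \<cdot> s\<^sup>\<star>) \<xi> \<otimes>\<^bsub>fibre \<xi>\<^esub> x = x"
      unfolding s(1) fibre_mult using gcomp_germ_fixed[OF \<xi> _ s(2)] c by (simp add: assoc)
    then show "\<one>\<^bsub>fibre \<xi>\<^esub> \<otimes>\<^bsub>fibre \<xi>\<^esub> x = x" using one[of "s \<cdot> s\<^sup>\<star>"] c by simp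
    show "\<exists>y\<in>carrier (fibre \<xi>). y \<otimes>\<^bsub>fibre \<xi>\<^esub> x = \<one>\<^bsub>fibre \<xi>\<^esub>"
      using inv[OF s(2)] germ_pairs_fixed_star[OF \<xi> s(2)] unfolding s(1) fibre_carrier[OF \<xi>] by blast
  qed
  show "inv\<^bsub>fibre \<xi>\<^esub> (germ S s \<xi>) = germ S (s\<^sup>\<star>) \<xi>" if s: "(s, \<xi>) \<in> germ_pairs S"
    by (rule group.inv_equality[OF grp inv[OF s]])
      (use s germ_pairs_fixed_star[OF \<xi> s] fibre_carrier[OF \<xi>] in auto)
qed

end

section \<open>The abelianization of an inverse semigroup\<close>

context inverse_semigroup
begin

lemma dualD:
  assumes "\<phi> \<in> dual S"
  shows "s \<in> carrier S \<Longrightarrow> \<phi> s = 0 \<or> cmod (\<phi> s) = 1"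
    "\<lbrakk>s \<in> carrier S; t \<in> carrier S\<rbrakk> \<Longrightarrow> \<phi> (s \<cdot> t) = \<phi> s * \<phi> t"
  using assms unfolding dual_def sgrp_hom_def circle_zero_def by (auto simp: PiE_iff)

text \<open>The convention \<open>inverse 0 = 0\<close> lets one formula cover the homomorphisms
  that vanish at s.\<close>

lemma dual_star:
  assumes \<phi>: "\<phi> \<in> dual S" and s: "s \<in> carrier S"
  shows "\<phi> (s\<^sup>\<star>) = inverse (\<phi> s)"
proof -
  have 1: "\<phi> s * (\<phi> (s\<^sup>\<star>) * \<phi> s) = \<phi> s" "\<phi> (s\<^sup>\<star>) * (\<phi> s * \<phi> (s\<^sup>\<star>)) = \<phi> (s\<^sup>\<star>)"
    using s by (simp_all flip: dualD(2)[OF \<phi>])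
  show ?thesis
  proof (cases "\<phi> s = 0")
    case True then show ?thesis using 1(2) by simp
  next
    case False
    then have "\<phi> (s\<^sup>\<star>) * \<phi> s = 1" using 1(1) by simp
    then show ?thesis by (metis inverse_unique mult.commute)
  qed
qed

abbreviation nu_class :: "'a \<Rightarrow> 'a set" where
  "nu_class s \<equiv> nu_ab S `` {s}"

lemma nu_ab_equiv: "equiv (carrier S) (nu_ab S)"
  by (rule equivI) (auto simp: nu_ab_def refl_on_def sym_def trans_def)

lemma nu_class_eq_iff:
  "\<lbrakk>s \<in> carrier S; t \<in> carrier S\<rbrakk> \<Longrightarrow> nu_class s = nu_class t \<longleftrightarrow> (\<forall>\<phi>\<in>dual S. \<phi> s = \<phi> t)"
  using eq_equiv_class_iff[OF nu_ab_equiv, of s t] by (simp add: nu_ab_def)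

lemma carrier_ab: "carrier (sgrp_ab S) = nu_class ` carrier S"
  by (auto simp: sgrp_ab_def quotient_sgrp_def quotient_def)

lemma nu_class_carrier [simp]: "s \<in> carrier S \<Longrightarrow> nu_class s \<in> carrier (sgrp_ab S)"
  by (simp add: carrier_ab)

lemma sprod_ab:
  assumes s: "s \<in> carrier S" and t: "t \<in> carrier S"
  shows "nu_class s \<cdot>\<^bsub>sgrp_ab S\<^esub> nu_class t = nu_class (s \<cdot> t)"
proof -
  have "nu_class (s' \<cdot> t') = nu_class (s \<cdot> t)" if "s' \<in> nu_class s" "t' \<in> nu_class t" for s' t'
  proof -
    have c: "s' \<in> carrier S" "t' \<in> carrier S"
      and eq: "\<And>\<phi>. \<phi> \<in> dual S \<Longrightarrow> \<phi> s = \<phi> s' \<and> \<phi> t = \<phi> t'"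
      using that by (auto simp: nu_ab_def)
    have "\<phi> (s' \<cdot> t') = \<phi> (s \<cdot> t)" if "\<phi> \<in> dual S" for \<phi>
      using eq[OF that] s t c by (simp add: dualD(2)[OF that])
    then show ?thesis using s t c by (simp add: nu_class_eq_iff)
  qed
  moreover have "s \<in> nu_class s" "t \<in> nu_class t" using s t by (auto simp: nu_ab_def)
  ultimately have "(\<Union>s'\<in>nu_class s. \<Union>t'\<in>nu_class t. nu_class (s' \<cdot> t')) = nu_class (s \<cdot> t)"
    by blast
  then show ?thesis by (simp add: sgrp_ab_def quotient_sgrp_def)
qed

lemma sprod_ab_commute:
  assumes "A \<in> carrier (sgrp_ab S)" "B \<in> carrier (sgrp_ab S)"
  shows "A \<cdot>\<^bsub>sgrp_ab S\<^esub> B = B \<cdot>\<^bsub>sgrp_ab S\<^esub> A"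
proof -
  obtain s t where "A = nu_class s" "s \<in> carrier S" "B = nu_class t" "t \<in> carrier S"
    using assms unfolding carrier_ab by blast
  then show ?thesis by (simp add: sprod_ab nu_class_eq_iff dualD(2) mult.commute)
qed

text \<open>The homomorphisms in \<open>dual S\<close> separate the classes, so uniqueness of
  inverses is decided in the circle with zero, where the two defining equations force the value
  \<open>inverse (\<phi> s)\<close>.\<close>

lemma inverse_semigroup_ab: "inverse_semigroup (sgrp_ab S)"
proof
  fix A B assume "A \<in> carrier (sgrp_ab S)" "B \<in> carrier (sgrp_ab S)"
  then obtain s t where "A = nu_class s" "s \<in> carrier S" "B = nu_class t" "t \<in> carrier S"
    unfolding carrier_ab by blast
  then show "A \<cdot>\<^bsub>sgrp_ab S\<^esub> B \<in> carrier (sgrp_ab S)" by (simp add: sprod_ab)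
next
  fix A B C assume "A \<in> carrier (sgrp_ab S)" "B \<in> carrier (sgrp_ab S)" "C \<in> carrier (sgrp_ab S)"
  then obtain s t u where "A = nu_class s" "s \<in> carrier S" "B = nu_class t" "t \<in> carrier S"
    "C = nu_class u" "u \<in> carrier S"
    unfolding carrier_ab by blast
  then show "A \<cdot>\<^bsub>sgrp_ab S\<^esub> B \<cdot>\<^bsub>sgrp_ab S\<^esub> C = A \<cdot>\<^bsub>sgrp_ab S\<^esub> (B \<cdot>\<^bsub>sgrp_ab S\<^esub> C)"
    by (simp add: sprod_ab assoc)
next
  fix A assume "A \<in> carrier (sgrp_ab S)"
  then obtain s where s: "A = nu_class s" "s \<in> carrier S" unfolding carrier_ab by blast
  show "\<exists>!B. is_star (sgrp_ab S) A B"
  proof (rule ex1I)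
    show "is_star (sgrp_ab S) A (nu_class (s\<^sup>\<star>))"
      using s by (simp add: is_star_def sprod_ab assoc)
    fix B assume B: "is_star (sgrp_ab S) A B"
    then obtain t where t: "B = nu_class t" "t \<in> carrier S" unfolding is_star_def carrier_ab by blast
    have st: "\<forall>\<phi>\<in>dual S. \<phi> s = \<phi> s * \<phi> t * \<phi> s" "\<forall>\<phi>\<in>dual S. \<phi> t = \<phi> t * \<phi> s * \<phi> t"
      using B s t by (simp_all add: is_star_def sprod_ab nu_class_eq_iff dualD(2))
    have "\<phi> t = inverse (\<phi> s)" if \<phi>: "\<phi> \<in> dual S" for \<phi>
    proof (cases "\<phi> s = 0")
      case True then show ?thesis using bspec[OF st(2) \<phi>] by simp
    next
      case False
      then have "\<phi> s * \<phi> t = 1" using bspec[OF st(1) \<phi>] by simp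
      then show ?thesis by (simp add: inverse_unique)
    qed
    then show "B = nu_class (s\<^sup>\<star>)" using s t by (simp add: nu_class_eq_iff dual_star)
  qed
qed

interpretation ab: inverse_semigroup "sgrp_ab S"
  by (rule inverse_semigroup_ab)

lemma star_ab:
  assumes "s \<in> carrier S"
  shows "star (sgrp_ab S) (nu_class s) = nu_class (star S s)"
  by (rule ab.star_eqI) (use assms in \<open>simp_all add: sprod_ab\<close>)

text \<open>If the class of s is idempotent, every \<phi> in the dual takes the value 0 or 1 at s,
  hence the same value at \<open>s\<^sup>\<star> \<cdot> s\<close>. So idempotents lift to
  idempotents, and semicharacters can be compared on both sides.\<close>

lemma idempotents_ab: "idempotents (sgrp_ab S) = nu_class ` idempotents S"
proof (intro equalityI subsetI)
  fix A assume "A \<in> idempotents (sgrp_ab S)"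
  then have A: "A \<in> carrier (sgrp_ab S)" "A \<cdot>\<^bsub>sgrp_ab S\<^esub> A = A" by auto
  then obtain s where s: "A = nu_class s" "s \<in> carrier S" unfolding carrier_ab by blast
  have sq: "\<forall>\<phi>\<in>dual S. \<phi> s * \<phi> s = \<phi> s"
    using A(2) s by (simp add: sprod_ab nu_class_eq_iff dualD(2))
  have "\<phi> s = \<phi> (star S s \<cdot> s)" if \<phi>: "\<phi> \<in> dual S" for \<phi>
    using bspec[OF sq \<phi>] s \<phi> by (cases "\<phi> s = 0") (simp_all add: dualD(2) dual_star)
  then have "A = nu_class (star S s \<cdot> s)" using s by (simp add: nu_class_eq_iff)
  then show "A \<in> nu_class ` idempotents S" using s by auto
next
  fix A assume "A \<in> nu_class ` idempotents S"
  then obtain e where e: "A = nu_class e" "e \<in> idempotents S" by blast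
  then show "A \<in> idempotents (sgrp_ab S)"
    by (intro ab.idempotentsI) (simp_all add: sprod_ab)
qed

lemma nu_class_idempotent [simp]: "e \<in> idempotents S \<Longrightarrow> nu_class e \<in> idempotents (sgrp_ab S)"
  by (simp add: idempotents_ab)

text \<open>By commutativity every unit over \<open>sgrp_ab S\<close> is fixed, so the results on
  isotropy groups apply to all of its universal groupoid.\<close>

lemma fixed_set_ab: "ab.fixed_set = idem_dual (sgrp_ab S)"
  using sprod_ab_commute by (auto simp: ab.fixed_set_def)

text \<open>If t has value 1, then \<open>beta S t\<close> fixes \<xi>, and conjugating
  \<open>s\<^sup>\<star> \<cdot> s\<close> by t does not change its value. If t has value 0, then so
  does the product, since \<open>star S (s \<cdot> t) \<cdot> (s \<cdot> t)\<close> lies below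
  \<open>s\<^sup>\<star> \<cdot> s\<close> conjugated by t and is absorbed by
  \<open>t\<^sup>\<star> \<cdot> t\<close>.\<close>

lemma fixed_set_product:
  assumes \<xi>: "\<xi> \<in> fixed_set" and s: "s \<in> carrier S" and t: "t \<in> carrier S"
  shows "\<xi> (star S (s \<cdot> t) \<cdot> (s \<cdot> t)) = \<xi> (star S s \<cdot> s) * \<xi> (star S t \<cdot> t)"
proof -
  note \<xi>' = fixed_setD[OF \<xi>]
  have e: "star S (s \<cdot> t) \<cdot> (s \<cdot> t) = star S t \<cdot> ((star S s \<cdot> s) \<cdot> t)"
    using s t by (simp add: star_product assoc)
  show ?thesis
  proof (cases "\<xi> (star S t \<cdot> t) = 1")
    case True
    then have "(t, \<xi>) \<in> germ_pairs S" using \<xi>' t by (simp add: germ_pairs_iff)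
    then have "beta S t \<xi> (star S s \<cdot> s) = \<xi> (star S s \<cdot> s)" using beta_fixed[OF \<xi>] by simp
    then show ?thesis unfolding e using True s t by (simp add: beta_apply)
  next
    case False
    then have 0: "\<xi> (star S t \<cdot> t) = 0" using idem_dualD(1)[OF \<xi>' star_product_idempotent(1)[OF t]] by simp
    have "(star S (s \<cdot> t) \<cdot> (s \<cdot> t)) \<cdot> (star S t \<cdot> t) = star S (s \<cdot> t) \<cdot> (s \<cdot> t)"
      using s t by (simp add: assoc)
    then have "\<xi> (star S (s \<cdot> t) \<cdot> (s \<cdot> t)) = \<xi> (star S (s \<cdot> t) \<cdot> (s \<cdot> t)) * \<xi> (star S t \<cdot> t)"
      using idem_dualD(2)[OF \<xi>', of "star S (s \<cdot> t) \<cdot> (s \<cdot> t)" "star S t \<cdot> t"] s t by simp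
    then show ?thesis using 0 by simp
  qed
qed

text \<open>By \<open>fixed_set_product\<close> a product lies in the support exactly when both
  factors do. On the support the germ map is multiplicative, and off it both sides are 0.\<close>

lemma dual_of_fibre_character:
  assumes \<xi>: "\<xi> \<in> fixed_set"
    and norm: "\<And>\<alpha>. \<alpha> \<in> carrier (fibre \<xi>) \<Longrightarrow> cmod (\<phi> \<alpha>) = 1"
    and mult: "\<And>\<alpha> \<beta>. \<lbrakk>\<alpha> \<in> carrier (fibre \<xi>); \<beta> \<in> carrier (fibre \<xi>)\<rbrakk> \<Longrightarrow>
      \<phi> (\<alpha> \<otimes>\<^bsub>fibre \<xi>\<^esub> \<beta>) = \<phi> \<alpha> * \<phi> \<beta>"
  shows "(\<lambda>s\<in>carrier S. if \<xi> (star S s \<cdot> s) = 1 then \<phi> (germ S s \<xi>) else 0) \<in> dual S"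
    (is "?f \<in> _")
proof -
  note \<xi>' = fixed_setD[OF \<xi>]
  have pair: "(s, \<xi>) \<in> germ_pairs S \<longleftrightarrow> \<xi> (star S s \<cdot> s) = 1" if "s \<in> carrier S" for s
    using \<xi>' that by (simp add: germ_pairs_iff)
  have fib: "germ S s \<xi> \<in> carrier (fibre \<xi>)" if "(s, \<xi>) \<in> germ_pairs S" for s
    using that fibre_carrier[OF \<xi>] by blast
  have "?f (s \<cdot> t) = ?f s * ?f t" if s: "s \<in> carrier S" and t: "t \<in> carrier S" for s t
  proof (cases "\<xi> (star S s \<cdot> s) = 1 \<and> \<xi> (star S t \<cdot> t) = 1")
    case True
    then have p: "(s, \<xi>) \<in> germ_pairs S" "(t, \<xi>) \<in> germ_pairs S" using pair s t by auto
    have "\<phi> (germ S (s \<cdot> t) \<xi>) = \<phi> (germ S s \<xi>) * \<phi> (germ S t \<xi>)"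
      using mult[OF fib[OF p(1)] fib[OF p(2)]] gcomp_germ_fixed[OF \<xi> p] by (simp add: fibre_mult)
    then show ?thesis using fixed_set_product[OF \<xi> s t] True s t by simp
  next
    case False
    then show ?thesis using fixed_set_product[OF \<xi> s t] s t by auto
  qed
  moreover have "?f \<in> carrier S \<rightarrow>\<^sub>E carrier circle_zero"
    using norm fib pair by (auto simp: circle_zero_def)
  ultimately show ?thesis unfolding dual_def sgrp_hom_def by (simp add: circle_zero_def)
qed

lemma fixed_set_nu_invariant:
  assumes \<xi>: "\<xi> \<in> fixed_set" and e: "e \<in> idempotents S" and f: "f \<in> idempotents S"
    and ef: "nu_class e = nu_class f"
  shows "\<xi> e = \<xi> f"
proof -
  note \<xi>' = fixed_setD[OF \<xi>]
  \<comment> \<open>The trivial character extended by 0; on idempotents it is \<xi> itself, read as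
    a complex number.\<close>
  define \<phi> where "\<phi> = (\<lambda>s\<in>carrier S. if \<xi> (star S s \<cdot> s) = 1 then 1 else 0 :: complex)"
  have "\<phi> \<in> dual S"
    unfolding \<phi>_def using dual_of_fibre_character[OF \<xi>, of "\<lambda>_. 1"] by simp
  then have "\<phi> e = \<phi> f" using ef e f by (simp add: nu_class_eq_iff)
  then have "\<xi> e = 1 \<longleftrightarrow> \<xi> f = 1" using e f by (auto simp: \<phi>_def split: if_splits)
  then show ?thesis using idem_dualD(1)[OF \<xi>' e] idem_dualD(1)[OF \<xi>' f] by auto
qed

section \<open>Fixed semicharacters and semicharacters of the abelianization\<close>

definition descend :: "('a \<Rightarrow> nat) \<Rightarrow> ('a set \<Rightarrow> nat)" where
  "descend \<xi> = (\<lambda>A\<in>idempotents (sgrp_ab S). \<xi> (SOME e. e \<in> idempotents S \<and> nu_class e = A))"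

definition pull :: "('a set \<Rightarrow> nat) \<Rightarrow> ('a \<Rightarrow> nat)" where
  "pull \<eta> = (\<lambda>e\<in>idempotents S. \<eta> (nu_class e))"

text \<open>As \<xi> lives on idempotents, the representative must be chosen among them. One exists
  by \<open>idempotents_ab\<close>, and the value does not depend on it by
  \<open>fixed_set_nu_invariant\<close>.\<close>

lemma descend_apply:
  assumes \<xi>: "\<xi> \<in> fixed_set" and e: "e \<in> idempotents S"
  shows "descend \<xi> (nu_class e) = \<xi> e"
proof -
  define f where "f = (SOME f. f \<in> idempotents S \<and> nu_class f = nu_class e)"
  have f: "f \<in> idempotents S \<and> nu_class f = nu_class e"
    unfolding f_def by (rule someI[of _ e]) (use e in simp)
  have "descend \<xi> (nu_class e) = \<xi> f" using e by (simp add: descend_def f_def)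
  also have "\<dots> = \<xi> e" using fixed_set_nu_invariant[OF \<xi>] f e by blast
  finally show ?thesis .
qed

lemma descend_idem_dual:
  assumes \<xi>: "\<xi> \<in> fixed_set"
  shows "descend \<xi> \<in> idem_dual (sgrp_ab S)"
proof -
  note \<xi>' = fixed_setD[OF \<xi>]
  obtain e where e: "e \<in> idempotents S" "\<xi> e = 1" using idem_dualD(4)[OF \<xi>'] by blast
  show ?thesis
  proof (rule ab.idem_dualI)
    fix A B assume "A \<in> idempotents (sgrp_ab S)" "B \<in> idempotents (sgrp_ab S)"
    then obtain e f where ef: "A = nu_class e" "e \<in> idempotents S" "B = nu_class f" "f \<in> idempotents S"
      unfolding idempotents_ab by blast
    then show "descend \<xi> (A \<cdot>\<^bsub>sgrp_ab S\<^esub> B) = descend \<xi> A * descend \<xi> B"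
      using idem_dualD(2)[OF \<xi>'] by (simp add: sprod_ab descend_apply[OF \<xi>] idempotents_product)
  next
    fix A assume "A \<in> idempotents (sgrp_ab S)"
    then obtain e where "A = nu_class e" "e \<in> idempotents S" unfolding idempotents_ab by blast
    then show "descend \<xi> A = 0 \<or> descend \<xi> A = 1"
      using idem_dualD(1)[OF \<xi>'] by (simp only: descend_apply[OF \<xi>])
  next
    show "descend \<xi> \<in> extensional (idempotents (sgrp_ab S))" by (simp add: descend_def)
    show "nu_class e \<in> idempotents (sgrp_ab S)" using e by simp
    show "descend \<xi> (nu_class e) = 1" using e by (simp add: descend_apply[OF \<xi>])
  qed
qed

text \<open>No homomorphism into the circle with zero distinguishes
  \<open>s\<^sup>\<star> \<cdot> s\<close> from \<open>s \<cdot> s\<^sup>\<star>\<close>, so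
  whatever comes from \<open>sgrp_ab S\<close> is automatically fixed.\<close>

lemma pull_fixed_set:
  assumes \<eta>: "\<eta> \<in> idem_dual (sgrp_ab S)"
  shows "pull \<eta> \<in> fixed_set"
proof -
  have "pull \<eta> \<in> idem_dual S"
  proof -
    obtain A where A: "A \<in> idempotents (sgrp_ab S)" "\<eta> A = 1" using ab.idem_dualD(4)[OF \<eta>] by blast
    then obtain e where e: "A = nu_class e" "e \<in> idempotents S" unfolding idempotents_ab by blast
    show ?thesis
    proof (rule idem_dualI)
      show "pull \<eta> e = 0 \<or> pull \<eta> e = 1" if "e \<in> idempotents S" for e
        using ab.idem_dualD(1)[OF \<eta> nu_class_idempotent[OF that]] that by (simp add: pull_def)
      show "pull \<eta> (e \<cdot> f) = pull \<eta> e * pull \<eta> f" if "e \<in> idempotents S" "f \<in> idempotents S" for e f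
        using ab.idem_dualD(2)[OF \<eta> nu_class_idempotent[OF that(1)] nu_class_idempotent[OF that(2)]]
          that idempotents_product[OF that]
        by (simp add: pull_def sprod_ab)
      show "pull \<eta> \<in> extensional (idempotents S)" by (simp add: pull_def)
      show "e \<in> idempotents S" by (fact e)
      show "pull \<eta> e = 1" using A e by (simp add: pull_def)
    qed
  qed
  moreover have "pull \<eta> (star S s \<cdot> s) = pull \<eta> (s \<cdot> star S s)" if s: "s \<in> carrier S" for s
  proof -
    have "nu_class (star S s \<cdot> s) = nu_class (s \<cdot> star S s)"
      using s by (simp add: nu_class_eq_iff dualD(2) mult.commute)
    then show ?thesis using s by (simp add: pull_def)
  qed
  ultimately show ?thesis unfolding fixed_set_def by blast
qed

lemma pull_descend: "\<xi> \<in> fixed_set \<Longrightarrow> pull (descend \<xi>) = \<xi>"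
proof
  fix e assume \<xi>: "\<xi> \<in> fixed_set"
  show "pull (descend \<xi>) e = \<xi> e"
    using idem_dualD(3)[OF fixed_setD[OF \<xi>]] descend_apply[OF \<xi>]
    by (cases "e \<in> idempotents S") (simp_all add: pull_def extensional_def)
qed

lemma descend_pull:
  assumes \<eta>: "\<eta> \<in> idem_dual (sgrp_ab S)"
  shows "descend (pull \<eta>) = \<eta>"
proof
  fix A show "descend (pull \<eta>) A = \<eta> A"
  proof (cases "A \<in> idempotents (sgrp_ab S)")
    case True
    then obtain e where "A = nu_class e" "e \<in> idempotents S" unfolding idempotents_ab by blast
    then show ?thesis using descend_apply[OF pull_fixed_set[OF \<eta>]] by (simp add: pull_def)
  next
    case False
    then show ?thesis using ab.idem_dualD(3)[OF \<eta>] by (simp add: descend_def extensional_def)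
  qed
qed

lemma germ_pairs_descend:
  assumes \<xi>: "\<xi> \<in> fixed_set" and s: "s \<in> carrier S"
  shows "(nu_class s, descend \<xi>) \<in> germ_pairs (sgrp_ab S) \<longleftrightarrow> (s, \<xi>) \<in> germ_pairs S"
  using s fixed_setD[OF \<xi>] descend_idem_dual[OF \<xi>] descend_apply[OF \<xi>, of "star S s \<cdot> s"]
  by (simp add: germ_pairs_iff ab.germ_pairs_iff star_ab sprod_ab)

text \<open>Since idempotents lift, the witness can be taken in S, and only the equation itself is
  read modulo \<open>nu_ab\<close>.\<close>

lemma germ_equiv_descend:
  assumes \<xi>: "\<xi> \<in> fixed_set" and s: "s \<in> carrier S" and t: "t \<in> carrier S"
  shows "ab.germ_equiv (descend \<xi>) (nu_class s) (nu_class t) \<longleftrightarrow>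
    (\<exists>e\<in>idempotents S. \<xi> e = 1 \<and> nu_class (s \<cdot> e) = nu_class (t \<cdot> e))"
  unfolding ab.germ_equiv_def idempotents_ab
  using s t by (simp add: descend_apply[OF \<xi>] sprod_ab)

section \<open>The homomorphism to the universal groupoid of the abelianization\<close>

definition germ_ab :: "('a \<times> ('a \<Rightarrow> nat)) set \<Rightarrow> ('a set \<times> ('a set \<Rightarrow> nat)) set" where
  "germ_ab \<alpha> = (case SOME p. p \<in> \<alpha> of (s, \<xi>) \<Rightarrow> germ (sgrp_ab S) (nu_class s) (descend \<xi>))"

text \<open>The witness for two representatives of a germ still works after passing to classes, so
  the choice made in \<open>germ_ab\<close> is immaterial.\<close>

lemma germ_ab_germ:
  assumes \<xi>: "\<xi> \<in> fixed_set" and s: "(s, \<xi>) \<in> germ_pairs S"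
  shows "germ_ab (germ S s \<xi>) = germ (sgrp_ab S) (nu_class s) (descend \<xi>)"
proof -
  have "(SOME p. p \<in> germ S s \<xi>) \<in> germ S s \<xi>" by (rule someI[of _ "(s, \<xi>)"]) (rule germ_self[OF s])
  then obtain t where t: "(SOME p. p \<in> germ S s \<xi>) = (t, \<xi>)" "(t, \<xi>) \<in> germ_pairs S" "germ_equiv \<xi> s t"
    unfolding germ_iff[OF s] by blast
  have c: "s \<in> carrier S" "t \<in> carrier S" using s t germ_pairs_iff by auto
  have "ab.germ_equiv (descend \<xi>) (nu_class s) (nu_class t)"
    unfolding germ_equiv_descend[OF \<xi> c] using t(3) unfolding germ_equiv_def by auto
  moreover have "(nu_class s, descend \<xi>) \<in> germ_pairs (sgrp_ab S)"
    "(nu_class t, descend \<xi>) \<in> germ_pairs (sgrp_ab S)"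
    using germ_pairs_descend[OF \<xi>] c s t by auto
  ultimately have "germ (sgrp_ab S) (nu_class s) (descend \<xi>) = germ (sgrp_ab S) (nu_class t) (descend \<xi>)"
    using ab.germ_eq_iff by blast
  then show ?thesis unfolding germ_ab_def t(1) by simp
qed

lemma descend_eq_iff: "\<lbrakk>\<xi> \<in> fixed_set; \<eta> \<in> fixed_set\<rbrakk> \<Longrightarrow> descend \<xi> = descend \<eta> \<longleftrightarrow> \<xi> = \<eta>"
  by (metis pull_descend)

lemma germ_ab_unit:
  assumes \<xi>: "\<xi> \<in> fixed_set"
  shows "germ_ab (unit_germ S \<xi>) = unit_germ (sgrp_ab S) (descend \<xi>)"
proof -
  obtain e where e: "e \<in> idempotents S" "\<xi> e = 1" using idem_dualD(4)[OF fixed_setD[OF \<xi>]] by blast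
  have "unit_germ S \<xi> = germ S e \<xi>" using unit_germ_eq[OF fixed_setD[OF \<xi>] e] .
  moreover have "unit_germ (sgrp_ab S) (descend \<xi>) = germ (sgrp_ab S) (nu_class e) (descend \<xi>)"
    using ab.unit_germ_eq[OF descend_idem_dual[OF \<xi>]] e by (simp add: descend_apply[OF \<xi>])
  ultimately show ?thesis
    using germ_ab_germ[OF \<xi> germ_pairs_idempotent[OF fixed_setD[OF \<xi>] e]] by simp
qed

lemma germ_ab_structure:
  assumes \<xi>: "\<xi> \<in> fixed_set" and s: "(s, \<xi>) \<in> germ_pairs S"
  shows "germ_ab (gdom (universal_groupoid S) (germ S s \<xi>)) =
      gdom (universal_groupoid (sgrp_ab S)) (germ_ab (germ S s \<xi>))"
    "germ_ab (gran (universal_groupoid S) (germ S s \<xi>)) =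
      gran (universal_groupoid (sgrp_ab S)) (germ_ab (germ S s \<xi>))"
    "germ_ab (ginv (universal_groupoid S) (germ S s \<xi>)) =
      ginv (universal_groupoid (sgrp_ab S)) (germ_ab (germ S s \<xi>))"
    "(t, \<xi>) \<in> germ_pairs S \<Longrightarrow>
      germ_ab (gcomp (universal_groupoid S) (germ S s \<xi>) (germ S t \<xi>)) =
      gcomp (universal_groupoid (sgrp_ab S)) (germ_ab (germ S s \<xi>)) (germ_ab (germ S t \<xi>))"
proof -
  have c: "s \<in> carrier S" using s germ_pairs_iff by blast
  have fx: "descend \<xi> \<in> ab.fixed_set" unfolding fixed_set_ab by (rule descend_idem_dual[OF \<xi>])
  have s': "(nu_class s, descend \<xi>) \<in> germ_pairs (sgrp_ab S)" using germ_pairs_descend[OF \<xi> c] s by simp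
  show "germ_ab (gdom (universal_groupoid S) (germ S s \<xi>)) =
      gdom (universal_groupoid (sgrp_ab S)) (germ_ab (germ S s \<xi>))"
    using gdom_germ[OF s] ab.gdom_germ[OF s'] germ_ab_unit[OF \<xi>] germ_ab_germ[OF \<xi> s] by simp
  show "germ_ab (gran (universal_groupoid S) (germ S s \<xi>)) =
      gran (universal_groupoid (sgrp_ab S)) (germ_ab (germ S s \<xi>))"
    using gran_germ_fixed[OF \<xi> s] ab.gran_germ_fixed[OF fx s'] germ_ab_unit[OF \<xi>] germ_ab_germ[OF \<xi> s]
    by simp
  show "germ_ab (ginv (universal_groupoid S) (germ S s \<xi>)) =
      ginv (universal_groupoid (sgrp_ab S)) (germ_ab (germ S s \<xi>))"
    using ginv_germ_fixed[OF \<xi> s] ab.ginv_germ_fixed[OF fx s'] germ_ab_germ[OF \<xi> s]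
      germ_ab_germ[OF \<xi> germ_pairs_fixed_star[OF \<xi> s]] star_ab[OF c] by simp
  show "germ_ab (gcomp (universal_groupoid S) (germ S s \<xi>) (germ S t \<xi>)) =
      gcomp (universal_groupoid (sgrp_ab S)) (germ_ab (germ S s \<xi>)) (germ_ab (germ S t \<xi>))"
    if t: "(t, \<xi>) \<in> germ_pairs S"
  proof -
    have c': "t \<in> carrier S" using t germ_pairs_iff by blast
    have t': "(nu_class t, descend \<xi>) \<in> germ_pairs (sgrp_ab S)" using germ_pairs_descend[OF \<xi> c'] t by simp
    show ?thesis
      using gcomp_germ_fixed[OF \<xi> s t] ab.gcomp_germ_fixed[OF fx s' t'] germ_ab_germ[OF \<xi> s]
        germ_ab_germ[OF \<xi> t] germ_ab_germ[OF \<xi> germ_pairs_fixed_product[OF \<xi> s t]] sprod_ab[OF c c'] by simp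
  qed
qed

lemma comm_group_fibre_ab:
  assumes "\<eta> \<in> idem_dual (sgrp_ab S)"
  shows "comm_group (ab.fibre \<eta>)"
proof -
  have \<eta>: "\<eta> \<in> ab.fixed_set" using assms fixed_set_ab by simp
  show ?thesis
  proof (rule group.group_comm_groupI[OF ab.fibre_is_group(1)[OF \<eta>]])
    fix x y assume "x \<in> carrier (ab.fibre \<eta>)" "y \<in> carrier (ab.fibre \<eta>)"
    then obtain A B where A: "x = germ (sgrp_ab S) A \<eta>" "(A, \<eta>) \<in> germ_pairs (sgrp_ab S)"
      and B: "y = germ (sgrp_ab S) B \<eta>" "(B, \<eta>) \<in> germ_pairs (sgrp_ab S)"
      unfolding ab.fibre_carrier[OF \<eta>] by blast
    then have "A \<cdot>\<^bsub>sgrp_ab S\<^esub> B = B \<cdot>\<^bsub>sgrp_ab S\<^esub> A"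
      using sprod_ab_commute ab.germ_pairs_iff by blast
    then show "x \<otimes>\<^bsub>ab.fibre \<eta>\<^esub> y = y \<otimes>\<^bsub>ab.fibre \<eta>\<^esub> x"
      using A B by (simp add: ab.fibre_mult ab.gcomp_germ_fixed[OF \<eta>])
  qed
qed

text \<open>The left side says that some idempotent of value 1 makes s and t equal modulo
  \<open>nu_ab\<close>. A character of the isotropy group can exploit this once it is extended to an
  element of the dual of S; if the quotient of the two germs were no product of commutators, some
  such character would tell them apart.\<close>

lemma germ_ab_eq_iff_derived:
  assumes \<xi>: "\<xi> \<in> fixed_set" and s: "(s, \<xi>) \<in> germ_pairs S" and t: "(t, \<xi>) \<in> germ_pairs S"
  shows "germ_ab (germ S s \<xi>) = germ_ab (germ S t \<xi>) \<longleftrightarrow>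
    germ S s \<xi> \<otimes>\<^bsub>fibre \<xi>\<^esub> inv\<^bsub>fibre \<xi>\<^esub> germ S t \<xi> \<in> derived (fibre \<xi>) (carrier (fibre \<xi>))"
proof -
  interpret F: group "fibre \<xi>" by (rule fibre_is_group(1)[OF \<xi>])
  have \<eta>: "descend \<xi> \<in> idem_dual (sgrp_ab S)" "descend \<xi> \<in> ab.fixed_set"
    unfolding fixed_set_ab using descend_idem_dual[OF \<xi>] by auto
  interpret A: comm_group "ab.fibre (descend \<xi>)" by (rule comm_group_fibre_ab[OF \<eta>(1)])
  have c: "s \<in> carrier S" "t \<in> carrier S" using s t germ_pairs_iff by auto
  define a b where ab: "a = germ S s \<xi>" "b = germ S t \<xi>"
  have fib: "a \<in> carrier (fibre \<xi>)" "b \<in> carrier (fibre \<xi>)"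
    using s t unfolding ab fibre_carrier[OF \<xi>] by auto
  show ?thesis unfolding ab[symmetric]
  proof
    have hom: "germ_ab \<in> hom (fibre \<xi>) (ab.fibre (descend \<xi>))"
    proof (rule homI)
      fix x assume "x \<in> carrier (fibre \<xi>)"
      then obtain u where u: "x = germ S u \<xi>" "(u, \<xi>) \<in> germ_pairs S" unfolding fibre_carrier[OF \<xi>] by blast
      then have "(nu_class u, descend \<xi>) \<in> germ_pairs (sgrp_ab S)"
        using germ_pairs_descend[OF \<xi>] germ_pairs_iff by blast
      then show "germ_ab x \<in> carrier (ab.fibre (descend \<xi>))"
        using germ_ab_germ[OF \<xi> u(2)] u(1) ab.fibre_carrier[OF \<eta>(2)] by blast
    next
      fix x y assume "x \<in> carrier (fibre \<xi>)" "y \<in> carrier (fibre \<xi>)"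
      then obtain u v where "x = germ S u \<xi>" "(u, \<xi>) \<in> germ_pairs S" "y = germ S v \<xi>" "(v, \<xi>) \<in> germ_pairs S"
        unfolding fibre_carrier[OF \<xi>] by blast
      then show "germ_ab (x \<otimes>\<^bsub>fibre \<xi>\<^esub> y) = germ_ab x \<otimes>\<^bsub>ab.fibre (descend \<xi>)\<^esub> germ_ab y"
        using germ_ab_structure(4)[OF \<xi>] by (simp add: fibre_mult ab.fibre_mult)
    qed
    interpret H: group_hom "fibre \<xi>" "ab.fibre (descend \<xi>)" germ_ab
      by unfold_locales (rule hom)
    assume "a \<otimes>\<^bsub>fibre \<xi>\<^esub> inv\<^bsub>fibre \<xi>\<^esub> b \<in> derived (fibre \<xi>) (carrier (fibre \<xi>))"
    then have "germ_ab (a \<otimes>\<^bsub>fibre \<xi>\<^esub> inv\<^bsub>fibre \<xi>\<^esub> b) \<in>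
        derived (ab.fibre (descend \<xi>)) (germ_ab ` carrier (fibre \<xi>))"
      using H.derived_img[of "carrier (fibre \<xi>)"] by blast
    also have "\<dots> = {\<one>\<^bsub>ab.fibre (descend \<xi>)\<^esub>}"
      by (rule A.derived_eq_singleton) (use hom in \<open>auto simp: hom_def\<close>)
    finally have "germ_ab a \<otimes>\<^bsub>ab.fibre (descend \<xi>)\<^esub> inv\<^bsub>ab.fibre (descend \<xi>)\<^esub> germ_ab b =
        \<one>\<^bsub>ab.fibre (descend \<xi>)\<^esub>"
      using fib by simp
    then show "germ_ab a = germ_ab b"
      using fib H.hom_closed A.inv_equality A.inv_inv A.inv_closed by metis
  next
    assume eq: "germ_ab a = germ_ab b"
    show "a \<otimes>\<^bsub>fibre \<xi>\<^esub> inv\<^bsub>fibre \<xi>\<^esub> b \<in> derived (fibre \<xi>) (carrier (fibre \<xi>))"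
    proof (rule ccontr)
      assume "a \<otimes>\<^bsub>fibre \<xi>\<^esub> inv\<^bsub>fibre \<xi>\<^esub> b \<notin> derived (fibre \<xi>) (carrier (fibre \<xi>))"
      then obtain \<phi> where \<phi>: "\<And>x. x \<in> carrier (fibre \<xi>) \<Longrightarrow> cmod (\<phi> x) = 1"
        "\<And>x y. x \<in> carrier (fibre \<xi>) \<Longrightarrow> y \<in> carrier (fibre \<xi>) \<Longrightarrow> \<phi> (x \<otimes>\<^bsub>fibre \<xi>\<^esub> y) = \<phi> x * \<phi> y"
        "\<phi> (a \<otimes>\<^bsub>fibre \<xi>\<^esub> inv\<^bsub>fibre \<xi>\<^esub> b) \<noteq> 1"
        using F.character_separates_from_derived[of "a \<otimes>\<^bsub>fibre \<xi>\<^esub> inv\<^bsub>fibre \<xi>\<^esub> b"] fib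
        by (metis F.inv_closed F.m_closed)
      define f where "f = (\<lambda>s\<in>carrier S. if \<xi> (star S s \<cdot> s) = 1 then \<phi> (germ S s \<xi>) else 0)"
      have f: "f \<in> dual S" unfolding f_def by (rule dual_of_fibre_character[OF \<xi> \<phi>(1,2)])
      have fval: "f u = \<phi> (germ S u \<xi>)" if "(u, \<xi>) \<in> germ_pairs S" for u
        using that by (simp add: f_def germ_pairs_iff)
      have "ab.germ_equiv (descend \<xi>) (nu_class s) (nu_class t)"
        using eq germ_pairs_descend[OF \<xi>] c s t ab.germ_eq_iff
        unfolding ab germ_ab_germ[OF \<xi> s] germ_ab_germ[OF \<xi> t] by blast
      then obtain e where e: "e \<in> idempotents S" "\<xi> e = 1" "nu_class (s \<cdot> e) = nu_class (t \<cdot> e)"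
        unfolding germ_equiv_descend[OF \<xi> c] by blast
      have ep: "(e, \<xi>) \<in> germ_pairs S" using germ_pairs_idempotent[OF fixed_setD[OF \<xi>]] e by blast
      then have "cmod (f e) = 1" using fval \<phi>(1) fibre_carrier[OF \<xi>] by auto
      then have "f e \<noteq> 0" by auto
      \<comment> \<open>Being in the dual of S, \<open>f\<close> respects the equality of classes,
        and the nonzero factor \<open>f e\<close> can then be cancelled.\<close>
      moreover have "f s * f e = f t * f e"
        using e(3) f c e(1) by (simp add: nu_class_eq_iff dualD(2)[OF f, symmetric])
      ultimately have "\<phi> a = \<phi> b" using fval s t unfolding ab by simp
      then have "\<phi> (a \<otimes>\<^bsub>fibre \<xi>\<^esub> inv\<^bsub>fibre \<xi>\<^esub> b) = \<phi> (b \<otimes>\<^bsub>fibre \<xi>\<^esub> inv\<^bsub>fibre \<xi>\<^esub> b)"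
        unfolding \<phi>(2)[OF fib(1) F.inv_closed[OF fib(2)]] \<phi>(2)[OF fib(2) F.inv_closed[OF fib(2)]]
        by simp
      also have "\<dots> = \<phi> \<one>\<^bsub>fibre \<xi>\<^esub>" using fib by simp
      also have "\<dots> = 1"
        using \<phi>(1)[OF F.one_closed] \<phi>(2)[OF F.one_closed F.one_closed]
        by (metis F.l_one F.one_closed mult_cancel_right1 norm_zero zero_neq_one)
      finally show False using \<phi>(3) by simp
    qed
  qed
qed

text \<open>Over different units both sides fail, because \<open>descend\<close> is injective on
  fixed semicharacters; over the same unit the question is settled in one isotropy group.\<close>

lemma germ_ab_eq_iff:
  assumes \<alpha>: "\<alpha> \<in> arrows fix_universal" and \<beta>: "\<beta> \<in> arrows fix_universal"
  shows "germ_ab \<alpha> = germ_ab \<beta> \<longleftrightarrow>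
    (\<alpha>, \<beta>) \<in> quotient_rel fix_universal (fix_commutators (universal_groupoid S))"
proof -
  obtain s \<xi> t \<eta> where s: "\<alpha> = germ S s \<xi>" "(s, \<xi>) \<in> germ_pairs S" "\<xi> \<in> fixed_set"
    and t: "\<beta> = germ S t \<eta>" "(t, \<eta>) \<in> germ_pairs S" "\<eta> \<in> fixed_set"
    using assms unfolding arrows_fix by blast
  have dom: "gdom (universal_groupoid S) \<alpha> = gdom (universal_groupoid S) \<beta> \<longleftrightarrow> \<xi> = \<eta>"
    using gdom_germ[OF s(2)] gdom_germ[OF t(2)] unit_germ_eq_iff s t fixed_setD by simp
  show ?thesis
  proof (cases "\<xi> = \<eta>")
    case False
    have "germ_ab \<alpha> \<noteq> germ_ab \<beta>"
    proof
      assume "germ_ab \<alpha> = germ_ab \<beta>"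
      then have "germ (sgrp_ab S) (nu_class s) (descend \<xi>) = germ (sgrp_ab S) (nu_class t) (descend \<eta>)"
        using germ_ab_germ s t by simp
      moreover have "(nu_class s, descend \<xi>) \<in> germ_pairs (sgrp_ab S)"
        "(nu_class t, descend \<eta>) \<in> germ_pairs (sgrp_ab S)"
        using germ_pairs_descend s t germ_pairs_iff by blast+
      ultimately have "descend \<xi> = descend \<eta>" using ab.germ_eq_iff by blast
      then show False using descend_eq_iff s t False by blast
    qed
    then show ?thesis using dom False by (simp add: quotient_rel_def)
  next
    case True
    define x where "x = germ S s \<xi> \<otimes>\<^bsub>fibre \<xi>\<^esub> inv\<^bsub>fibre \<xi>\<^esub> germ S t \<xi>"
    have t': "(t, \<xi>) \<in> germ_pairs S" using t True by simp
    have der: "derived (fibre \<zeta>) (carrier (fibre \<zeta>)) \<subseteq> carrier (fibre \<zeta>)" if "\<zeta> \<in> fixed_set" for \<zeta>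
      using group.derived_in_carrier[OF fibre_is_group(1)[OF that]] by blast
    have xc: "x \<in> carrier (fibre \<xi>)"
    proof -
      interpret F: group "fibre \<xi>" by (rule fibre_is_group(1)[OF s(3)])
      have "germ S s \<xi> \<in> carrier (fibre \<xi>)" "germ S t \<xi> \<in> carrier (fibre \<xi>)"
        using s(2) t' unfolding fibre_carrier[OF s(3)] by auto
      then show ?thesis unfolding x_def by simp
    qed
    \<comment> \<open>Fibres over different units are disjoint, so membership in the union
      \<open>fix_commutators\<close> is decided in the fibre of \<xi>.\<close>
    have uniq: "\<zeta> = \<xi>" if "\<zeta> \<in> fixed_set" "x \<in> carrier (fibre \<zeta>)" for \<zeta>
    proof -
      have "gdom (universal_groupoid S) x = unit_germ S \<zeta>" "gdom (universal_groupoid S) x = unit_germ S \<xi>"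
        using that(2) xc by (simp_all add: fibre_group_def)
      then show ?thesis using unit_germ_eq_iff fixed_setD that(1) s(3) by simp
    qed
    have "x = gcomp (universal_groupoid S) \<alpha> (ginv (universal_groupoid S) \<beta>)"
      unfolding x_def fibre_mult using fibre_is_group(2)[OF s(3) t'] ginv_germ_fixed[OF s(3) t'] s t True
      by simp
    moreover have "x \<in> fix_commutators (universal_groupoid S) \<longleftrightarrow> x \<in> derived (fibre \<xi>) (carrier (fibre \<xi>))"
      unfolding fix_commutators_def fixed_points_universal using der uniq s(3) by blast
    ultimately have "(\<alpha>, \<beta>) \<in> quotient_rel fix_universal (fix_commutators (universal_groupoid S)) \<longleftrightarrow>
        x \<in> derived (fibre \<xi>) (carrier (fibre \<xi>))"
      using \<alpha> \<beta> dom True by (simp add: quotient_rel_def)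
    then show ?thesis
      using germ_ab_eq_iff_derived[OF s(3) s(2) t'] s t True unfolding x_def by simp
  qed
qed

end

section \<open>The isomorphism\<close>

lemma topspace_quotient_topology: "topspace (quotient_topology X R) = topspace X // R"
proof (rule antisym)
  show "topspace (quotient_topology X R) \<subseteq> topspace X // R"
    using openin_topspace[of "quotient_topology X R"] unfolding openin_quotient_topology by blast
  have "{x \<in> topspace X. R `` {x} \<in> topspace X // R} = topspace X" by (auto intro: quotientI)
  then have "openin (quotient_topology X R) (topspace X // R)" by (simp add: openin_quotient_topology)
  then show "topspace X // R \<subseteq> topspace (quotient_topology X R)" by (rule openin_subset)
qed

text \<open>The first isomorphism theorem for topological groupoids: p and the projection modulo N
  have the same fibres, and both are quotient maps. The hypothesis \<open>inj\<close> says that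
  composability can be tested after applying p, so composable arrows of K have composable
  lifts.\<close>

theorem quotient_groupoid_isomorphic:
  fixes G :: "'a groupoid" and K :: "'b groupoid"
  assumes quot: "quotient_map (gtop G) (gtop K) p"
    and ker: "\<And>\<alpha> \<beta>. \<lbrakk>\<alpha> \<in> arrows G; \<beta> \<in> arrows G\<rbrakk> \<Longrightarrow> p \<alpha> = p \<beta> \<longleftrightarrow> (\<alpha>, \<beta>) \<in> quotient_rel G N"
    and closed: "\<And>\<alpha>. \<alpha> \<in> arrows G \<Longrightarrow> gdom G \<alpha> \<in> arrows G \<and> gran G \<alpha> \<in> arrows G \<and> ginv G \<alpha> \<in> arrows G"
    and closed_comp: "\<And>\<alpha> \<beta>. \<lbrakk>\<alpha> \<in> arrows G; \<beta> \<in> arrows G; gdom G \<alpha> = gran G \<beta>\<rbrakk> \<Longrightarrow> gcomp G \<alpha> \<beta> \<in> arrows G"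
    and hom: "\<And>\<alpha>. \<alpha> \<in> arrows G \<Longrightarrow> p (gdom G \<alpha>) = gdom K (p \<alpha>) \<and> p (gran G \<alpha>) = gran K (p \<alpha>) \<and>
        p (ginv G \<alpha>) = ginv K (p \<alpha>)"
    and hom_comp: "\<And>\<alpha> \<beta>. \<lbrakk>\<alpha> \<in> arrows G; \<beta> \<in> arrows G; gdom G \<alpha> = gran G \<beta>\<rbrakk> \<Longrightarrow>
        p (gcomp G \<alpha> \<beta>) = gcomp K (p \<alpha>) (p \<beta>)"
    and inj: "\<And>\<alpha> \<beta>. \<lbrakk>\<alpha> \<in> arrows G; \<beta> \<in> arrows G; p (gdom G \<alpha>) = p (gran G \<beta>)\<rbrakk> \<Longrightarrow> gdom G \<alpha> = gran G \<beta>"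
  shows "groupoid_isomorphic K (quotient_groupoid G N)"
proof -
  define R where "R = quotient_rel G N"
  \<comment> \<open>Sending x to its whole fibre under p gives a class directly, without choosing a
    lift.\<close>
  define f where "f x = {\<alpha> \<in> arrows G. p \<alpha> = x}" for x
  have f: "f (p \<alpha>) = R `` {\<alpha>}" if "\<alpha> \<in> arrows G" for \<alpha>
  proof -
    have "R `` {\<alpha>} = {\<beta> \<in> arrows G. (\<alpha>, \<beta>) \<in> R}" unfolding R_def quotient_rel_def by blast
    also have "\<dots> = f (p \<alpha>)" unfolding f_def R_def using ker[OF that] by force
    finally show ?thesis by simp
  qed
  have self: "\<alpha> \<in> f (p \<alpha>)" if "\<alpha> \<in> arrows G" for \<alpha> using that by (simp add: f_def)
  have surj: "p ` arrows G = arrows K" using quot by (simp add: quotient_map_def)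
  have top: "gtop (quotient_groupoid G N) = quotient_topology (gtop G) R"
    by (simp add: quotient_groupoid_def Let_def R_def)
  have img: "f ` arrows K = arrows G // R"
    unfolding surj[symmetric] quotient_def using f by auto
  \<comment> \<open>A homeomorphism is an injective quotient map, and openness on both sides is
    tested on the same subset of G.\<close>
  have "quotient_map (gtop K) (quotient_topology (gtop G) R) f"
    unfolding quotient_map_def topspace_quotient_topology
  proof (intro conjI allI impI)
    show "f ` arrows K = arrows G // R" by (rule img)
    fix W assume W: "W \<subseteq> arrows G // R"
    define V where "V = {x \<in> arrows K. f x \<in> W}"
    have "openin (gtop K) V \<longleftrightarrow> openin (gtop G) {\<alpha> \<in> arrows G. p \<alpha> \<in> V}"
    proof -
      have "V \<subseteq> arrows K" unfolding V_def by blast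
      then show ?thesis using quot unfolding quotient_map_def by simp
    qed
    also have "{\<alpha> \<in> arrows G. p \<alpha> \<in> V} = {\<alpha> \<in> arrows G. R `` {\<alpha>} \<in> W}"
      unfolding V_def using f surj by force
    finally show "openin (gtop K) {x \<in> arrows K. f x \<in> W} \<longleftrightarrow> openin (quotient_topology (gtop G) R) W"
      unfolding openin_quotient_topology V_def using W by simp
  qed
  moreover have "inj_on f (arrows K)"
  proof (rule inj_onI)
    fix x y assume xy: "x \<in> arrows K" "y \<in> arrows K" "f x = f y"
    then obtain \<alpha> where \<alpha>: "\<alpha> \<in> arrows G" "x = p \<alpha>" unfolding surj[symmetric] by blast
    have "\<alpha> \<in> f y" using self[OF \<alpha>(1)] unfolding \<alpha>(2)[symmetric] xy(3) .
    then show "x = y" using \<alpha>(2) unfolding f_def by simp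
  qed
  ultimately have homeo: "homeomorphic_map (gtop K) (gtop (quotient_groupoid G N)) f"
    unfolding top homeomorphic_map_def by blast
  \<comment> \<open>Domain, range and inverse are unions over representatives of the same shape and
    are treated together.\<close>
  have unary: "f (k (p \<alpha>)) = (\<Union>\<gamma>\<in>f (p \<alpha>). R `` {g \<gamma>})"
    if \<alpha>: "\<alpha> \<in> arrows G" and g: "\<And>\<gamma>. \<gamma> \<in> arrows G \<Longrightarrow> g \<gamma> \<in> arrows G \<and> p (g \<gamma>) = k (p \<gamma>)" for \<alpha> g k
  proof -
    have "R `` {g \<gamma>} = f (k (p \<alpha>))" if "\<gamma> \<in> f (p \<alpha>)" for \<gamma>
    proof -
      have \<gamma>: "\<gamma> \<in> arrows G" "p \<gamma> = p \<alpha>" using that unfolding f_def by auto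
      show ?thesis using f[of "g \<gamma>"] g[OF \<gamma>(1)] \<gamma>(2) by simp
    qed
    then show ?thesis using self[OF \<alpha>] by blast
  qed
  have "groupoid_isomorphism K (quotient_groupoid G N) f"
    unfolding groupoid_isomorphism_def
  proof (intro conjI ballI impI)
    show "homeomorphic_map (gtop K) (gtop (quotient_groupoid G N)) f" by (rule homeo)
  next
    fix x assume "x \<in> arrows K"
    then obtain \<alpha> where \<alpha>: "\<alpha> \<in> arrows G" "x = p \<alpha>" unfolding surj[symmetric] by blast
    show "f (gdom K x) = gdom (quotient_groupoid G N) (f x)"
      using unary[OF \<alpha>(1), of "gdom G" "gdom K"] closed hom \<alpha>(2)
      by (simp add: quotient_groupoid_def Let_def R_def)
    show "f (gran K x) = gran (quotient_groupoid G N) (f x)"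
      using unary[OF \<alpha>(1), of "gran G" "gran K"] closed hom \<alpha>(2)
      by (simp add: quotient_groupoid_def Let_def R_def)
    show "f (ginv K x) = ginv (quotient_groupoid G N) (f x)"
      using unary[OF \<alpha>(1), of "ginv G" "ginv K"] closed hom \<alpha>(2)
      by (simp add: quotient_groupoid_def Let_def R_def)
  next
    fix x y assume x: "x \<in> arrows K" and y: "y \<in> arrows K" and xy: "gdom K x = gran K y"
    \<comment> \<open>By \<open>inj\<close> arbitrary lifts of x and y are composable, so the side
      condition in the composition of classes excludes no pair.\<close>
    have comp: "gdom G \<alpha> = gran G \<beta> \<and> R `` {gcomp G \<alpha> \<beta>} = f (gcomp K x y)"
      if "\<alpha> \<in> f x" "\<beta> \<in> f y" for \<alpha> \<beta>
    proof -
      have \<alpha>: "\<alpha> \<in> arrows G" "p \<alpha> = x" and \<beta>: "\<beta> \<in> arrows G" "p \<beta> = y"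
        using that unfolding f_def by auto
      have dr: "gdom G \<alpha> = gran G \<beta>" using inj[OF \<alpha>(1) \<beta>(1)] hom[OF \<alpha>(1)] hom[OF \<beta>(1)] \<alpha> \<beta> xy by simp
      then show ?thesis
        using f[OF closed_comp[OF \<alpha>(1) \<beta>(1) dr]] hom_comp[OF \<alpha>(1) \<beta>(1) dr] \<alpha>(2) \<beta>(2) by simp
    qed
    obtain \<alpha> \<beta> where \<alpha>\<beta>: "\<alpha> \<in> f x" "\<beta> \<in> f y"
      using x y self unfolding surj[symmetric] by blast
    have "(\<Union>\<alpha>\<in>f x. \<Union>\<beta>\<in>{\<beta> \<in> f y. gdom G \<alpha> = gran G \<beta>}. R `` {gcomp G \<alpha> \<beta>}) = f (gcomp K x y)"
    proof (intro equalityI subsetI)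
      fix \<gamma> assume "\<gamma> \<in> (\<Union>\<alpha>\<in>f x. \<Union>\<beta>\<in>{\<beta> \<in> f y. gdom G \<alpha> = gran G \<beta>}. R `` {gcomp G \<alpha> \<beta>})"
      then show "\<gamma> \<in> f (gcomp K x y)" using comp by blast
    next
      fix \<gamma> assume "\<gamma> \<in> f (gcomp K x y)"
      then show "\<gamma> \<in> (\<Union>\<alpha>\<in>f x. \<Union>\<beta>\<in>{\<beta> \<in> f y. gdom G \<alpha> = gran G \<beta>}. R `` {gcomp G \<alpha> \<beta>})"
        using comp[OF \<alpha>\<beta>] \<alpha>\<beta> by blast
    qed
    then show "f (gcomp K x y) = gcomp (quotient_groupoid G N) (f x) (f y)"
      by (simp add: quotient_groupoid_def Let_def R_def)
  qed
  then show ?thesis unfolding groupoid_isomorphic_def by blast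
qed

context inverse_semigroup
begin

lemma continuous_map_into_idem_dual:
  assumes "\<And>x. x \<in> topspace X \<Longrightarrow> f x \<in> idem_dual S"
    and "\<And>e. e \<in> idempotents S \<Longrightarrow> continuous_map X (discrete_topology {0, 1}) (\<lambda>x. f x e)"
  shows "continuous_map X (idem_dual_top S) f"
  unfolding idem_dual_top_def continuous_map_in_subtopology continuous_map_componentwise
  using assms idem_dualD(3) by blast

interpretation ab: inverse_semigroup "sgrp_ab S"
  by (rule inverse_semigroup_ab)

text \<open>Both topologies are those of pointwise convergence, and the two maps only rename the
  points of evaluation: evaluating \<open>descend \<xi>\<close> at the class of e is evaluating
  \<xi> at e.\<close>

lemma homeomorphic_maps_descend:
  "homeomorphic_maps (subtopology (idem_dual_top S) fixed_set) (idem_dual_top (sgrp_ab S)) descend pull"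
  unfolding homeomorphic_maps_def
proof (intro conjI ballI)
  have ts: "topspace (subtopology (idem_dual_top S) fixed_set) = fixed_set"
    using fixed_setD by (auto simp: topspace_idem_dual_top)
  show "continuous_map (subtopology (idem_dual_top S) fixed_set) (idem_dual_top (sgrp_ab S)) descend"
  proof (rule ab.continuous_map_into_idem_dual)
    show "descend \<xi> \<in> idem_dual (sgrp_ab S)"
      if "\<xi> \<in> topspace (subtopology (idem_dual_top S) fixed_set)" for \<xi>
      using that descend_idem_dual unfolding ts by blast
    fix A assume "A \<in> idempotents (sgrp_ab S)"
    then obtain e where e: "A = nu_class e" "e \<in> idempotents S" unfolding idempotents_ab by blast
    show "continuous_map (subtopology (idem_dual_top S) fixed_set) (discrete_topology {0, 1})
        (\<lambda>\<xi>. descend \<xi> A)"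
      by (rule continuous_map_eq[OF continuous_map_from_subtopology[OF continuous_map_eval[OF e(2)]]])
        (use e descend_apply ts in auto)
  qed
  have "continuous_map (idem_dual_top (sgrp_ab S)) (idem_dual_top S) pull"
  proof (rule continuous_map_into_idem_dual)
    show "pull \<eta> \<in> idem_dual S" if "\<eta> \<in> topspace (idem_dual_top (sgrp_ab S))" for \<eta>
      using that pull_fixed_set fixed_setD unfolding ab.topspace_idem_dual_top by blast
    fix e assume e: "e \<in> idempotents S"
    then show "continuous_map (idem_dual_top (sgrp_ab S)) (discrete_topology {0, 1}) (\<lambda>\<eta>. pull \<eta> e)"
      using ab.continuous_map_eval[OF nu_class_idempotent[OF e]] by (simp add: pull_def)
  qed
  then show "continuous_map (idem_dual_top (sgrp_ab S)) (subtopology (idem_dual_top S) fixed_set) pull"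
    using pull_fixed_set unfolding continuous_map_in_subtopology ab.topspace_idem_dual_top by blast
  show "pull (descend \<xi>) = \<xi>" if "\<xi> \<in> topspace (subtopology (idem_dual_top S) fixed_set)" for \<xi>
    using that pull_descend unfolding ts by blast
  show "descend (pull \<eta>) = \<eta>" if "\<eta> \<in> topspace (idem_dual_top (sgrp_ab S))" for \<eta>
    using that descend_pull unfolding ab.topspace_idem_dual_top by blast
qed

lemma openin_descend_iff:
  assumes "V \<subseteq> idem_dual (sgrp_ab S)"
  shows "openin (idem_dual_top (sgrp_ab S)) V \<longleftrightarrow>
    openin (subtopology (idem_dual_top S) fixed_set) {\<xi> \<in> fixed_set. descend \<xi> \<in> V}"
proof -
  have "quotient_map (subtopology (idem_dual_top S) fixed_set) (idem_dual_top (sgrp_ab S)) descend"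
    using homeomorphic_maps_imp_map[OF homeomorphic_maps_descend] by (simp add: homeomorphic_map_def)
  moreover have ts: "topspace (subtopology (idem_dual_top S) fixed_set) = fixed_set"
    using fixed_setD by (auto simp: topspace_idem_dual_top)
  ultimately show ?thesis
    using assms unfolding quotient_map_def ab.topspace_idem_dual_top ts by blast
qed

text \<open>In the charts of s and of its class, \<open>germ_ab\<close> becomes
  \<open>descend\<close>. Since \<open>descend\<close> is a homeomorphism, slices of V are open
  exactly when the corresponding slices of its preimage are.\<close>

lemma quotient_map_germ_ab:
  "quotient_map (gtop fix_universal) (gtop (universal_groupoid (sgrp_ab S))) germ_ab"
  unfolding quotient_map_def
proof (intro conjI allI impI)
  \<comment> \<open>Surjectivity: the class is lifted to s and the semicharacter to
    \<open>pull \<eta>\<close>.\<close>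
  have ab_pair: "\<exists>s \<xi>. A = nu_class s \<and> \<eta> = descend \<xi> \<and> \<xi> \<in> fixed_set \<and> (s, \<xi>) \<in> germ_pairs S"
    if "(A, \<eta>) \<in> germ_pairs (sgrp_ab S)" for A \<eta>
  proof -
    have "A \<in> carrier (sgrp_ab S)" and \<eta>: "\<eta> \<in> idem_dual (sgrp_ab S)"
      using that ab.germ_pairs_iff by auto
    then obtain s where s: "A = nu_class s" "s \<in> carrier S" unfolding carrier_ab by blast
    have "(s, pull \<eta>) \<in> germ_pairs S"
      using germ_pairs_descend[OF pull_fixed_set[OF \<eta>] s(2)] that s(1) descend_pull[OF \<eta>] by simp
    then show ?thesis using s(1) pull_fixed_set[OF \<eta>] descend_pull[OF \<eta>] by metis
  qed
  show "germ_ab ` arrows fix_universal = arrows (universal_groupoid (sgrp_ab S))"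
  proof (intro equalityI subsetI)
    fix x assume "x \<in> germ_ab ` arrows fix_universal"
    then obtain s \<xi> where s: "x = germ_ab (germ S s \<xi>)" "(s, \<xi>) \<in> germ_pairs S" "\<xi> \<in> fixed_set"
      unfolding arrows_fix by blast
    then have "(nu_class s, descend \<xi>) \<in> germ_pairs (sgrp_ab S)"
      using germ_pairs_descend germ_pairs_iff by blast
    then show "x \<in> arrows (universal_groupoid (sgrp_ab S))"
      unfolding s(1) germ_ab_germ[OF s(3,2)] ab.arrows_universal by blast
  next
    fix x assume "x \<in> arrows (universal_groupoid (sgrp_ab S))"
    then obtain A \<eta> where "x = germ (sgrp_ab S) A \<eta>" "(A, \<eta>) \<in> germ_pairs (sgrp_ab S)"
      unfolding ab.arrows_universal by blast
    then obtain s \<xi> where s: "x = germ (sgrp_ab S) (nu_class s) (descend \<xi>)" "\<xi> \<in> fixed_set"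
      "(s, \<xi>) \<in> germ_pairs S" using ab_pair by metis
    then have "x = germ_ab (germ S s \<xi>)" using germ_ab_germ by simp
    then show "x \<in> germ_ab ` arrows fix_universal" unfolding arrows_fix using s by blast
  qed
  fix V assume V: "V \<subseteq> arrows (universal_groupoid (sgrp_ab S))"
  have local: "openin (subtopology (idem_dual_top S) fixed_set)
      {\<xi>. (s, \<xi>) \<in> germ_pairs S \<and> germ S s \<xi> \<in> {\<alpha> \<in> arrows fix_universal. germ_ab \<alpha> \<in> V}} \<longleftrightarrow>
    openin (idem_dual_top (sgrp_ab S))
      {\<eta>. (nu_class s, \<eta>) \<in> germ_pairs (sgrp_ab S) \<and> germ (sgrp_ab S) (nu_class s) \<eta> \<in> V}"
    if s: "s \<in> carrier S" for s
  proof -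
    let ?W = "{\<eta>. (nu_class s, \<eta>) \<in> germ_pairs (sgrp_ab S) \<and> germ (sgrp_ab S) (nu_class s) \<eta> \<in> V}"
    have sub: "?W \<subseteq> idem_dual (sgrp_ab S)" using ab.germ_pairs_iff by blast
    have "(s, \<xi>) \<in> germ_pairs S \<and> germ S s \<xi> \<in> {\<alpha> \<in> arrows fix_universal. germ_ab \<alpha> \<in> V} \<longleftrightarrow>
        \<xi> \<in> fixed_set \<and> descend \<xi> \<in> ?W" for \<xi>
      using germ_in_fix_iff germ_pairs_descend[OF _ s] germ_ab_germ by auto
    then have "{\<xi>. (s, \<xi>) \<in> germ_pairs S \<and> germ S s \<xi> \<in> {\<alpha> \<in> arrows fix_universal. germ_ab \<alpha> \<in> V}} =
        {\<xi> \<in> fixed_set. descend \<xi> \<in> ?W}"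
      by auto
    then show ?thesis using openin_descend_iff[OF sub] by simp
  qed
  \<comment> \<open>Every chart of the target belongs to the class of some s, so the two chart
    criteria match one by one.\<close>
  show "openin (gtop fix_universal) {\<alpha> \<in> arrows fix_universal. germ_ab \<alpha> \<in> V} \<longleftrightarrow>
      openin (gtop (universal_groupoid (sgrp_ab S))) V"
    unfolding openin_fix ab.openin_universal carrier_ab using V local by simp
qed

theorem universal_groupoid_ab_isomorphic:
  "groupoid_isomorphic (universal_groupoid (sgrp_ab S)) (groupoid_ab (universal_groupoid S))"
  unfolding groupoid_ab_def
proof (rule quotient_groupoid_isomorphic[OF quotient_map_germ_ab germ_ab_eq_iff], unfold fix_groupoid_simps)
  have unit: "unit_germ S \<xi> \<in> arrows fix_universal" if \<xi>: "\<xi> \<in> fixed_set" for \<xi>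
  proof -
    obtain e where e: "e \<in> idempotents S" "\<xi> e = 1" using idem_dualD(4)[OF fixed_setD[OF \<xi>]] by blast
    have "(e, \<xi>) \<in> germ_pairs S" using germ_pairs_idempotent[OF fixed_setD[OF \<xi>] e] .
    then show ?thesis unfolding unit_germ_eq[OF fixed_setD[OF \<xi>] e] using germ_in_fix_iff \<xi> by blast
  qed
  {
    fix \<alpha> assume "\<alpha> \<in> arrows fix_universal"
    then obtain s \<xi> where s: "\<alpha> = germ S s \<xi>" "(s, \<xi>) \<in> germ_pairs S" "\<xi> \<in> fixed_set"
      unfolding arrows_fix by blast
    show "gdom (universal_groupoid S) \<alpha> \<in> arrows fix_universal \<and>
        gran (universal_groupoid S) \<alpha> \<in> arrows fix_universal \<and>
        ginv (universal_groupoid S) \<alpha> \<in> arrows fix_universal"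
      unfolding s(1) gdom_germ[OF s(2)] gran_germ_fixed[OF s(3,2)] ginv_germ_fixed[OF s(3,2)]
      using unit[OF s(3)] germ_in_fix_iff[OF germ_pairs_fixed_star[OF s(3,2)]] s(3) by simp
    show "germ_ab (gdom (universal_groupoid S) \<alpha>) = gdom (universal_groupoid (sgrp_ab S)) (germ_ab \<alpha>) \<and>
        germ_ab (gran (universal_groupoid S) \<alpha>) = gran (universal_groupoid (sgrp_ab S)) (germ_ab \<alpha>) \<and>
        germ_ab (ginv (universal_groupoid S) \<alpha>) = ginv (universal_groupoid (sgrp_ab S)) (germ_ab \<alpha>)"
      unfolding s(1) using germ_ab_structure(1-3)[OF s(3,2)] by simp
  }
  fix \<alpha> \<beta> assume "\<alpha> \<in> arrows fix_universal" "\<beta> \<in> arrows fix_universal"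
  then obtain s \<xi> t \<eta> where s: "\<alpha> = germ S s \<xi>" "(s, \<xi>) \<in> germ_pairs S" "\<xi> \<in> fixed_set"
    and t: "\<beta> = germ S t \<eta>" "(t, \<eta>) \<in> germ_pairs S" "\<eta> \<in> fixed_set"
    unfolding arrows_fix by blast
  have dr: "gdom (universal_groupoid S) \<alpha> = unit_germ S \<xi>" "gran (universal_groupoid S) \<beta> = unit_germ S \<eta>"
    using gdom_germ[OF s(2)] gran_germ_fixed[OF t(3,2)] s(1) t(1) by auto
  {
    assume "gdom (universal_groupoid S) \<alpha> = gran (universal_groupoid S) \<beta>"
    then have "\<eta> = \<xi>" using dr unit_germ_eq_iff fixed_setD s(3) t(3) by simp
    then have t': "\<beta> = germ S t \<xi>" "(t, \<xi>) \<in> germ_pairs S" using t by auto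
    show "gcomp (universal_groupoid S) \<alpha> \<beta> \<in> arrows fix_universal"
      unfolding s(1) t'(1) gcomp_germ_fixed[OF s(3,2) t'(2)]
      using germ_in_fix_iff[OF germ_pairs_fixed_product[OF s(3,2) t'(2)]] s(3) by simp
    show "germ_ab (gcomp (universal_groupoid S) \<alpha> \<beta>) =
        gcomp (universal_groupoid (sgrp_ab S)) (germ_ab \<alpha>) (germ_ab \<beta>)"
      unfolding s(1) t'(1) by (rule germ_ab_structure(4)[OF s(3,2) t'(2)])
  }
  \<comment> \<open>This is the hypothesis \<open>inj\<close>: on units \<open>germ_ab\<close> is
    \<open>descend\<close>, which is injective.\<close>
  assume "germ_ab (gdom (universal_groupoid S) \<alpha>) = germ_ab (gran (universal_groupoid S) \<beta>)"
  then have "unit_germ (sgrp_ab S) (descend \<xi>) = unit_germ (sgrp_ab S) (descend \<eta>)"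
    unfolding dr germ_ab_unit[OF s(3)] germ_ab_unit[OF t(3)] .
  then have "\<xi> = \<eta>"
    using ab.unit_germ_eq_iff descend_idem_dual descend_eq_iff s(3) t(3) by simp
  then show "gdom (universal_groupoid S) \<alpha> = gran (universal_groupoid S) \<beta>" using dr by simp
qed

end


theorem theorem4p2p3:
  fixes S :: "'a sgrp"
  assumes "inverse_semigroup S"
  shows "groupoid_isomorphic (universal_groupoid (sgrp_ab S)) (groupoid_ab (universal_groupoid S))"
  using inverse_semigroup.universal_groupoid_ab_isomorphic[OF assms] .

end
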